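(* Let $T>0$, let $\Omega\subset\mathbb{R}^d$ ($d=1,2,3$) be a bounded Lipschitz domain, $Q_T:=\Omega\times(0,T)$, and let $c\in L^\infty(\Omega)$ with $c(\boldsymbol{x})\ge c_0$ for some constant $c_0>0$. Then $$\mathcal{A}(U,\mathcal{L}_TU)\ge\frac{1}{2eT}\,\|U\|_{\mathcal{V}(Q_T)}^2\qquad\text{for all }U\in H^1(0,T;H_0^1(\Omega))\cap H^2_{0,\bullet}(0,T;L^2(\Omega)).$$
   Context: $H^2_{0,\bullet}(0,T;L^2(\Omega)):=\{U\in H^2(0,T;L^2(\Omega)):U(\cdot,0)=0\}$. The bilinear form is $$\mathcal{A}(U,W):=(\partial_t^2U,\partial_tW)_{L^2(Q_T)}+(\partial_tU(\cdot,0),\partial_tW(\cdot,0))_{L^2(\Omega)}+(c^2\nabla_{\boldsymbol{x}}U,\nabla_{\boldsymbol{x}}\partial_tW)_{L^2(Q_T)},$$ the operator $\mathcal{L}_T$ is $\mathcal{L}_TW(\boldsymbol{x},t):=\int_0^te^{-s/T}\partial_sW(\boldsymbol{x},s)\,\mathrm{d}s$, and $\|U\|_{\mathcal{V}(Q_T)}^2:=\|\partial_tU\|_{L^2(Q_T)}^2+\|c\nabla_{\boldsymbol{x}}U\|_{L^2(Q_T)}^2$. *)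

theory Defs
  imports "HOL-Analysis.Analysis"
begin

section \<open>The Hilbert space of square-integrable functions\<close>

text \<open>The type of classes modulo null sets of Lebesgue measurable, square-integrable functions on
  the whole space. It is made a separable Hilbert space here so that the Bochner integral of the
  library applies to functions with values in it.\<close>

definition square_integrable :: "('a::euclidean_space \<Rightarrow> 'b::euclidean_space) \<Rightarrow> bool" where
  "square_integrable f \<longleftrightarrow>
     f \<in> borel_measurable lebesgue \<and> integrable lebesgue (\<lambda>x. (norm (f x))\<^sup>2)"

definition L2_rel :: "('a::euclidean_space \<Rightarrow> 'b::euclidean_space) \<Rightarrow> ('a \<Rightarrow> 'b) \<Rightarrow> bool" where
  "L2_rel f g \<longleftrightarrow> square_integrable f \<and> square_integrable g \<and> (AE x in lebesgue. f x = g x)"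

lemma square_integrable_zero: "square_integrable (\<lambda>_. 0)"
  by (simp add: square_integrable_def)

lemma square_integrable_scaleR: "square_integrable f \<Longrightarrow> square_integrable (\<lambda>x. r *\<^sub>R f x)"
  by (auto simp: square_integrable_def power_mult_distrib)

lemma square_integrable_add:
  fixes f g :: "'a::euclidean_space \<Rightarrow> 'b::euclidean_space"
  assumes "square_integrable f" "square_integrable g"
  shows "square_integrable (\<lambda>x. f x + g x)"
  unfolding square_integrable_def
proof
  have [measurable]: "f \<in> borel_measurable lebesgue" "g \<in> borel_measurable lebesgue"
    using assms by (auto simp: square_integrable_def)
  show "(\<lambda>x. f x + g x) \<in> borel_measurable lebesgue" by measurable
  have "integrable lebesgue (\<lambda>x. 2 * (norm (f x))\<^sup>2 + 2 * (norm (g x))\<^sup>2)"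
    using assms by (auto simp: square_integrable_def)
  moreover have "(norm (a + b))\<^sup>2 \<le> 2 * (norm a)\<^sup>2 + 2 * (norm b)\<^sup>2" for a b :: 'b
  proof -
    have "(norm (a + b))\<^sup>2 \<le> (norm a + norm b)\<^sup>2"
      by (simp add: norm_triangle_ineq power_mono)
    also have "\<dots> \<le> 2 * (norm a)\<^sup>2 + 2 * (norm b)\<^sup>2"
      using zero_le_power2[of "norm a - norm b"] by (simp add: power2_eq_square algebra_simps)
    finally show ?thesis .
  qed
  ultimately show "integrable lebesgue (\<lambda>x. (norm (f x + g x))\<^sup>2)"
    by (elim Bochner_Integration.integrable_bound) auto
qed

lemma square_integrable_uminus: "square_integrable f \<Longrightarrow> square_integrable (\<lambda>x. - f x)"
  using square_integrable_scaleR[of f "-1"] by simp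

lemma square_integrable_diff:
  "square_integrable f \<Longrightarrow> square_integrable g \<Longrightarrow> square_integrable (\<lambda>x. f x - g x)"
  using square_integrable_add[of f "\<lambda>x. - g x"] square_integrable_uminus[of g] by simp

lemma square_integrable_inner:
  fixes f g :: "'a::euclidean_space \<Rightarrow> 'b::euclidean_space"
  assumes "square_integrable f" "square_integrable g"
  shows "integrable lebesgue (\<lambda>x. f x \<bullet> g x)"
proof -
  have [measurable]: "f \<in> borel_measurable lebesgue" "g \<in> borel_measurable lebesgue"
    using assms by (auto simp: square_integrable_def)
  have "integrable lebesgue (\<lambda>x. (norm (f x))\<^sup>2 + (norm (g x))\<^sup>2)"
    using assms by (auto simp: square_integrable_def)
  moreover have "norm (a \<bullet> b) \<le> norm ((norm a)\<^sup>2 + (norm b)\<^sup>2)" for a b :: 'b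
  proof -
    have "norm (a \<bullet> b) \<le> norm a * norm b" by (simp add: Cauchy_Schwarz_ineq2)
    also have "\<dots> \<le> (norm a)\<^sup>2 + (norm b)\<^sup>2"
    proof -
      have "0 \<le> norm a * norm b" by simp
      moreover have "2 * (norm a * norm b) \<le> (norm a)\<^sup>2 + (norm b)\<^sup>2"
        using sum_squares_bound[of "norm a" "norm b"] by (simp add: mult.assoc)
      ultimately show ?thesis by linarith
    qed
    finally show ?thesis by simp
  qed
  ultimately show ?thesis
    by (elim Bochner_Integration.integrable_bound) auto
qed

quotient_type (overloaded) ('a, 'b) L2 =
  "'a::euclidean_space \<Rightarrow> 'b::euclidean_space" / partial: L2_rel
proof (rule part_equivpI)
  show "\<exists>x. L2_rel x x"
    by (rule exI[of _ "\<lambda>_. 0"]) (simp add: L2_rel_def square_integrable_zero)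
  show "symp L2_rel" by (auto simp: symp_def L2_rel_def elim: AE_mp)
  show "transp L2_rel" unfolding transp_def L2_rel_def by auto
qed

instantiation L2 :: (euclidean_space, euclidean_space) real_vector
begin

lift_definition zero_L2 :: "('a, 'b) L2" is "\<lambda>_. 0"
  by (simp add: L2_rel_def square_integrable_zero)

lift_definition plus_L2 :: "('a, 'b) L2 \<Rightarrow> ('a, 'b) L2 \<Rightarrow> ('a, 'b) L2" is "\<lambda>f g x. f x + g x"
  by (auto simp: L2_rel_def square_integrable_add)

lift_definition minus_L2 :: "('a, 'b) L2 \<Rightarrow> ('a, 'b) L2 \<Rightarrow> ('a, 'b) L2" is "\<lambda>f g x. f x - g x"
  by (auto simp: L2_rel_def square_integrable_diff)

lift_definition uminus_L2 :: "('a, 'b) L2 \<Rightarrow> ('a, 'b) L2" is "\<lambda>f x. - f x"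
  by (auto simp: L2_rel_def square_integrable_uminus)

lift_definition scaleR_L2 :: "real \<Rightarrow> ('a, 'b) L2 \<Rightarrow> ('a, 'b) L2" is "\<lambda>r f x. r *\<^sub>R f x"
  by (auto simp: L2_rel_def square_integrable_scaleR)

instance
proof
  fix f g h :: "('a, 'b) L2" and r s :: real
  show "f + g + h = f + (g + h)" "f + g = g + f" "0 + f = f" "- f + f = 0" "f - g = f + - g"
    "r *\<^sub>R (f + g) = r *\<^sub>R f + r *\<^sub>R g" "(r + s) *\<^sub>R f = r *\<^sub>R f + s *\<^sub>R f"
    "r *\<^sub>R s *\<^sub>R f = (r * s) *\<^sub>R f" "1 *\<^sub>R f = f"
    by (transfer; force simp: L2_rel_def algebra_simps square_integrable_zero
        intro!: square_integrable_add square_integrable_diff square_integrable_scaleR square_integrable_uminus)+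
qed

end

instantiation L2 :: (euclidean_space, euclidean_space) real_inner
begin

lift_definition inner_L2 :: "('a, 'b) L2 \<Rightarrow> ('a, 'b) L2 \<Rightarrow> real"
  is "\<lambda>f g. \<integral>x. f x \<bullet> g x \<partial>lebesgue"
  unfolding L2_rel_def
  by (intro integral_cong_AE borel_measurable_inner) (auto simp: square_integrable_def)

definition norm_L2 :: "('a, 'b) L2 \<Rightarrow> real" where
  "norm_L2 f = sqrt (f \<bullet> f)"

definition sgn_L2 :: "('a, 'b) L2 \<Rightarrow> ('a, 'b) L2" where
  "sgn_L2 f = f /\<^sub>R norm f"

definition dist_L2 :: "('a, 'b) L2 \<Rightarrow> ('a, 'b) L2 \<Rightarrow> real" where
  "dist_L2 f g = norm (f - g)"

definition [code del]:
  "(uniformity :: (('a, 'b) L2 \<times> ('a, 'b) L2) filter) = (INF e\<in>{0<..}. principal {(x, y). dist x y < e})"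

definition [code del]:
  "open (U :: ('a, 'b) L2 set) \<longleftrightarrow> (\<forall>x\<in>U. eventually (\<lambda>(x', y). x' = x \<longrightarrow> y \<in> U) uniformity)"

instance
proof
  fix f g h :: "('a, 'b) L2" and r s :: real
  show "f \<bullet> g = g \<bullet> f" by transfer (simp add: inner_commute)
  show "(f + g) \<bullet> h = f \<bullet> h + g \<bullet> h"
    by transfer (auto simp: L2_rel_def inner_add_left square_integrable_inner)
  show "(r *\<^sub>R f) \<bullet> g = r * (f \<bullet> g)" by transfer auto
  show "0 \<le> f \<bullet> f" by transfer auto
  show "(f \<bullet> f = 0) = (f = 0)"
    by transfer (auto simp: L2_rel_def square_integrable_zero integral_nonneg_eq_0_iff_AE square_integrable_inner)
qed (simp_all add: norm_L2_def sgn_L2_def dist_L2_def uniformity_L2_def open_L2_def)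

end

lemma rep_L2: "square_integrable (rep_L2 f)"
  using Quotient3_rep_reflp[OF Quotient3_L2, of f] by (simp add: L2_rel_def)

lemma abs_rep_L2: "abs_L2 (rep_L2 f) = f"
  by (rule Quotient3_abs_rep[OF Quotient3_L2])

lemma rep_abs_L2:
  assumes "square_integrable f"
  shows "AE x in lebesgue. rep_L2 (abs_L2 f) x = f x"
  using rep_abs_rsp_left[OF Quotient3_L2, of f f] assms by (auto simp: L2_rel_def)

lemma abs_L2_eq_iff:
  assumes "square_integrable f" "square_integrable g"
  shows "abs_L2 f = abs_L2 g \<longleftrightarrow> (AE x in lebesgue. f x = g x)"
  using Quotient3_rel[OF Quotient3_L2, of f g] assms by (auto simp: L2_rel_def)

lemma
  assumes "square_integrable f" "square_integrable g"
  shows abs_L2_add: "abs_L2 f + abs_L2 g = abs_L2 (\<lambda>x. f x + g x)"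
    and abs_L2_diff: "abs_L2 f - abs_L2 g = abs_L2 (\<lambda>x. f x - g x)"
    and abs_L2_scaleR: "r *\<^sub>R abs_L2 f = abs_L2 (\<lambda>x. r *\<^sub>R f x)"
    and abs_L2_inner: "abs_L2 f \<bullet> abs_L2 g = (\<integral>x. f x \<bullet> g x \<partial>lebesgue)"
  using assms
  by (simp_all add: plus_L2.abs_eq minus_L2.abs_eq scaleR_L2.abs_eq inner_L2.abs_eq eq_onp_def L2_rel_def)

lemma norm_abs_L2_sq:
  "square_integrable f \<Longrightarrow> (norm (abs_L2 f))\<^sup>2 = (\<integral>x. (norm (f x))\<^sup>2 \<partial>lebesgue)"
  by (simp add: power2_norm_eq_inner abs_L2_inner)

lemma nn_integral_abs_L2:
  "square_integrable f \<Longrightarrow> (\<integral>\<^sup>+x. ennreal ((norm (f x))\<^sup>2) \<partial>lebesgue) = ennreal ((norm (abs_L2 f))\<^sup>2)"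
  unfolding norm_abs_L2_sq by (rule nn_integral_eq_integral) (auto simp: square_integrable_def)

lemma square_integrable_iff_nn:
  "square_integrable f \<longleftrightarrow> f \<in> borel_measurable lebesgue \<and> (\<integral>\<^sup>+x. ennreal ((norm (f x))\<^sup>2) \<partial>lebesgue) < \<infinity>"
  unfolding square_integrable_def integrable_iff_bounded by auto

lemma convergent_if_fast:
  fixes f :: "nat \<Rightarrow> 'b::banach"
  assumes "summable (\<lambda>n. norm (f (Suc n) - f n))"
  shows "f \<longlonglongrightarrow> lim f"
proof -
  have "summable (\<lambda>n. f (Suc n) - f n)" using assms by (rule summable_norm_cancel)
  then have "convergent (\<lambda>n. \<Sum>i<n. f (Suc i) - f i)" by (simp add: summable_iff_convergent)
  then have "convergent (\<lambda>n. f n - f 0)" by (simp add: sum_lessThan_telescope)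
  then have "convergent (\<lambda>n. (f n - f 0) + f 0)" by (intro convergent_add convergent_const)
  then show ?thesis by (simp add: convergent_LIMSEQ_iff)
qed

lemma L2_fast_convergent:
  fixes X :: "nat \<Rightarrow> ('a::euclidean_space, 'b::euclidean_space) L2"
  assumes X: "\<And>n. dist (X (Suc n)) (X n) \<le> (1/4) ^ n" and "Cauchy X"
  shows "convergent X"
proof -
  define f where "f n = rep_L2 (X n)" for n
  have sq: "square_integrable (f n)" for n by (simp add: f_def rep_L2)
  have [measurable]: "f n \<in> borel_measurable lebesgue" for n
    using sq[of n] by (simp add: square_integrable_def)
  have X_eq: "X n = abs_L2 (f n)" for n by (simp add: f_def abs_rep_L2)
  have dist_eq: "(\<integral>\<^sup>+x. ennreal ((norm (f m x - f n x))\<^sup>2) \<partial>lebesgue) = ennreal ((dist (X m) (X n))\<^sup>2)" for m n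
    unfolding dist_norm X_eq abs_L2_diff[OF sq sq]
    by (rule nn_integral_abs_L2) (simp add: square_integrable_diff sq)
  define h where "h n x = ennreal (4 ^ n * (norm (f (Suc n) x - f n x))\<^sup>2)" for n x
  have [measurable]: "h n \<in> borel_measurable lebesgue" for n unfolding h_def by measurable
  have h_int: "(\<integral>\<^sup>+x. h n x \<partial>lebesgue) \<le> ennreal ((1/4) ^ n)" for n
  proof -
    have "(\<integral>\<^sup>+x. h n x \<partial>lebesgue) = ennreal (4 ^ n) * (\<integral>\<^sup>+x. ennreal ((norm (f (Suc n) x - f n x))\<^sup>2) \<partial>lebesgue)"
      unfolding h_def by (subst nn_integral_cmult[symmetric]) (auto simp: ennreal_mult)
    also have "\<dots> = ennreal (4 ^ n * (dist (X (Suc n)) (X n))\<^sup>2)"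
      by (simp add: dist_eq ennreal_mult)
    also have "\<dots> \<le> ennreal (4 ^ n * ((1/4) ^ n)\<^sup>2)"
      using X[of n] by (intro ennreal_leI mult_left_mono power_mono) auto
    also have "4 ^ n * ((1/4) ^ n)\<^sup>2 = ((1/4) ^ n :: real)"
      by (simp add: power2_eq_square field_simps power_divide)
    finally show ?thesis .
  qed
  have "(\<integral>\<^sup>+x. (\<Sum>n. h n x) \<partial>lebesgue) = (\<Sum>n. \<integral>\<^sup>+x. h n x \<partial>lebesgue)"
    by (rule nn_integral_suminf) simp
  also have "\<dots> \<le> (\<Sum>n. ennreal ((1/4) ^ n))"
    by (intro suminf_le h_int) auto
  also have "\<dots> = ennreal (\<Sum>n. (1/4) ^ n)"
    by (intro suminf_ennreal2) (auto simp: summable_geometric)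
  also have "\<dots> < \<infinity>" by simp
  finally have "AE x in lebesgue. (\<Sum>n. h n x) \<noteq> \<infinity>"
    by (intro nn_integral_PInf_AE) auto
  then have lim: "AE x in lebesgue. (\<lambda>n. f n x) \<longlonglongrightarrow> lim (\<lambda>n. f n x)"
  proof (rule AE_mp[OF _ AE_I2], safe)
    fix x assume "(\<Sum>n. h n x) \<noteq> \<infinity>"
    then obtain C where C: "0 \<le> C" "(\<Sum>n. h n x) = ennreal C" by (cases "\<Sum>n. h n x") auto
    have four: "((2::real) ^ n)\<^sup>2 = 4 ^ n" for n by (simp add: power2_eq_square flip: power_mult_distrib)
    have "norm (norm (f (Suc n) x - f n x)) \<le> sqrt C * (1/2) ^ n" for n
    proof -
      have "h n x \<le> ennreal C"
        using sum_le_suminf[of "\<lambda>n. h n x" "{n}"] C by simp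
      then have "4 ^ n * (norm (f (Suc n) x - f n x))\<^sup>2 \<le> C"
        using C by (simp add: h_def)
      then have "(2 ^ n * norm (f (Suc n) x - f n x))\<^sup>2 \<le> C"
        by (simp add: power_mult_distrib four)
      then have "2 ^ n * norm (f (Suc n) x - f n x) \<le> sqrt C"
        by (simp add: real_le_rsqrt)
      then show ?thesis by (simp add: field_simps power_divide)
    qed
    moreover have "summable (\<lambda>n. sqrt C * (1/2) ^ n)"
      by (rule summable_mult) (simp add: summable_geometric)
    ultimately have "summable (\<lambda>n. norm (f (Suc n) x - f n x))"
      by (rule summable_comparison_test'[where N = 0, rotated])
    then show "(\<lambda>n. f n x) \<longlonglongrightarrow> lim (\<lambda>n. f n x)" by (rule convergent_if_fast)
  qed
  define g where "g x = lim (\<lambda>n. f n x)" for x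
  have g_meas [measurable]: "g \<in> borel_measurable lebesgue" unfolding g_def by measurable
  have fatou: "(\<integral>\<^sup>+x. ennreal ((norm (g x - f n x))\<^sup>2) \<partial>lebesgue) \<le> ennreal (e\<^sup>2)"
    if "\<And>m. m \<ge> N \<Longrightarrow> dist (X m) (X n) \<le> e" "0 \<le> e" for n N e
  proof -
    have "(\<integral>\<^sup>+x. ennreal ((norm (g x - f n x))\<^sup>2) \<partial>lebesgue) =
        (\<integral>\<^sup>+x. liminf (\<lambda>m. ennreal ((norm (f m x - f n x))\<^sup>2)) \<partial>lebesgue)"
    proof (rule nn_integral_cong_AE, rule AE_mp[OF lim AE_I2], safe)
      fix x assume "(\<lambda>n. f n x) \<longlonglongrightarrow> lim (\<lambda>n. f n x)"
      then have "(\<lambda>m. ennreal ((norm (f m x - f n x))\<^sup>2)) \<longlonglongrightarrow> ennreal ((norm (g x - f n x))\<^sup>2)"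
        unfolding g_def by (intro tendsto_intros)
      then show "ennreal ((norm (g x - f n x))\<^sup>2) = liminf (\<lambda>m. ennreal ((norm (f m x - f n x))\<^sup>2))"
        by (intro lim_imp_Liminf[symmetric]) simp_all
    qed
    also have "\<dots> \<le> liminf (\<lambda>m. \<integral>\<^sup>+x. ennreal ((norm (f m x - f n x))\<^sup>2) \<partial>lebesgue)"
      by (rule nn_integral_liminf) measurable
    also have "\<dots> \<le> liminf (\<lambda>m::nat. ennreal (e\<^sup>2))"
    proof (rule Liminf_mono)
      show "\<forall>\<^sub>F m in sequentially. (\<integral>\<^sup>+x. ennreal ((norm (f m x - f n x))\<^sup>2) \<partial>lebesgue) \<le> ennreal (e\<^sup>2)"
        using eventually_ge_at_top[of N]
        by eventually_elim (auto simp: dist_eq intro!: ennreal_leI power_mono that)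
    qed
    also have "\<dots> = ennreal (e\<^sup>2)" by (simp add: Liminf_const)
    finally show ?thesis .
  qed
  have sq_diff: "square_integrable (\<lambda>x. g x - f n x)" for n
  proof -
    obtain e N where "e \<ge> 0" "\<And>m. m \<ge> N \<Longrightarrow> dist (X m) (X n) \<le> e"
    proof -
      obtain N where N: "\<And>m. m \<ge> N \<Longrightarrow> dist (X m) (X N) < 1"
        using \<open>Cauchy X\<close> by (meson Cauchy_altdef2 zero_less_one)
      show thesis
      proof (rule that[of "1 + dist (X N) (X n)" N])
        show "0 \<le> 1 + dist (X N) (X n)" by simp
        show "dist (X m) (X n) \<le> 1 + dist (X N) (X n)" if "m \<ge> N" for m
          using N[OF that] dist_triangle[of "X m" "X n" "X N"] by linarith
      qed
    qed
    then have "(\<integral>\<^sup>+x. ennreal ((norm (g x - f n x))\<^sup>2) \<partial>lebesgue) \<le> ennreal (e\<^sup>2)"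
      by (intro fatou)
    also have "\<dots> < \<infinity>" by simp
    finally show ?thesis by (simp add: square_integrable_iff_nn)
  qed
  have sq_g: "square_integrable g"
    using square_integrable_add[OF sq_diff[of 0] sq[of 0]] by simp
  have "X \<longlonglongrightarrow> abs_L2 g"
  proof (rule metric_LIMSEQ_I)
    fix r :: real assume "r > 0"
    then obtain N where N: "\<And>m n. m \<ge> N \<Longrightarrow> n \<ge> N \<Longrightarrow> dist (X m) (X n) < r / 2"
      using \<open>Cauchy X\<close> by (meson Cauchy_def half_gt_zero)
    have "dist (X n) (abs_L2 g) < r" if "n \<ge> N" for n
    proof -
      have "ennreal ((norm (abs_L2 (\<lambda>x. g x - f n x)))\<^sup>2) \<le> ennreal ((r/2)\<^sup>2)"
        unfolding nn_integral_abs_L2[OF sq_diff, symmetric]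
        using N \<open>r > 0\<close> that by (intro fatou[of N]) (auto intro: less_imp_le)
      then have "(norm (abs_L2 g - X n))\<^sup>2 \<le> (r/2)\<^sup>2"
        by (simp add: X_eq abs_L2_diff sq sq_g)
      then have "norm (abs_L2 g - X n) \<le> r / 2"
        using \<open>r > 0\<close> by (meson power2_le_imp_le half_gt_zero less_imp_le)
      then show ?thesis using \<open>r > 0\<close> by (simp add: dist_norm norm_minus_commute)
    qed
    then show "\<exists>no. \<forall>n\<ge>no. dist (X n) (abs_L2 g) < r" by blast
  qed
  then show ?thesis by (auto simp: convergent_def)
qed

instance L2 :: (euclidean_space, euclidean_space) banach
proof
  fix X :: "nat \<Rightarrow> ('a, 'b) L2" assume X: "Cauchy X"
  have "\<exists>N. \<forall>m\<ge>N. \<forall>n\<ge>N. dist (X m) (X n) < (1/4) ^ k" for k :: nat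
    using X unfolding Cauchy_def by simp
  then obtain N where N: "\<And>k m n. m \<ge> N k \<Longrightarrow> n \<ge> N k \<Longrightarrow> dist (X m) (X n) < (1/4) ^ k"
    by metis
  define r where "r k = (\<Sum>i\<le>k. Suc (N i))" for k
  have r_mono: "strict_mono r" unfolding strict_mono_Suc_iff r_def by simp
  have r_ge: "r k \<ge> N k" for k
    unfolding r_def using member_le_sum[of k "{..k}" "\<lambda>i. Suc (N i)"] by auto
  have "dist ((X \<circ> r) (Suc k)) ((X \<circ> r) k) \<le> (1/4) ^ k" for k
    using N[of k "r (Suc k)" "r k"] r_ge[of k] strict_mono_less[OF r_mono, of k "Suc k"]
    by (simp add: less_imp_le)
  moreover have "Cauchy (X \<circ> r)" using X r_mono by (rule Cauchy_subseq_Cauchy)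
  ultimately have "convergent (X \<circ> r)" by (rule L2_fast_convergent)
  then show "convergent X"
    using Cauchy_converges_subseq[OF X r_mono] by (auto simp: convergent_def)
qed

lemma separable_imp_countable_basis:
  fixes D :: "'a::metric_space set"
  assumes "countable D" "closure D = UNIV"
  shows "\<exists>B::'a set set. countable B \<and> open = generate_topology B"
proof -
  define B where "B = (\<lambda>(d, n). ball d (1 / real (Suc n))) ` (D \<times> (UNIV :: nat set))"
  have "countable B" using assms by (auto simp: B_def)
  moreover have "topological_basis B"
  proof (rule topological_basisI)
    show "open U" if "U \<in> B" for U using that by (auto simp: B_def)
    fix U :: "'a set" and x assume "open U" "x \<in> U"
    then obtain e where e: "e > 0" "ball x e \<subseteq> U" by (auto simp: open_contains_ball)
    obtain n where n: "1 / real (Suc n) < e / 2"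
      using nat_approx_posE[of "e/2"] e(1) by (metis half_gt_zero)
    obtain d where d: "d \<in> D" "dist d x < 1 / real (Suc n)"
      using assms(2) closure_approachable[of x D]
      by (metis UNIV_I divide_pos_pos of_nat_0_less_iff zero_less_Suc zero_less_one)
    have "ball d (1 / real (Suc n)) \<subseteq> ball x e"
    proof
      fix y assume "y \<in> ball d (1 / real (Suc n))"
      then show "y \<in> ball x e"
        using d n dist_triangle[of x y d] by (simp add: dist_commute)
    qed
    then have "ball d (1 / real (Suc n)) \<in> B \<and> x \<in> ball d (1 / real (Suc n)) \<and> ball d (1 / real (Suc n)) \<subseteq> U"
      using d e by (auto simp: B_def)
    then show "\<exists>B'\<in>B. x \<in> B' \<and> B' \<subseteq> U" by blast
  qed
  ultimately show ?thesis by (auto simp: topological_basis_imp_subbasis)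
qed

lemma subspace_closureI:
  fixes D :: "'a::real_normed_vector set"
  assumes "0 \<in> D" "\<And>x y. x \<in> D \<Longrightarrow> y \<in> D \<Longrightarrow> x + y \<in> D"
    and "\<And>q x. q \<in> \<rat> \<Longrightarrow> x \<in> D \<Longrightarrow> q *\<^sub>R x \<in> D"
  shows "subspace (closure D)"
proof (rule subspaceI)
  show "0 \<in> closure D" using assms(1) closure_subset by auto
  show "x + y \<in> closure D" if "x \<in> closure D" "y \<in> closure D" for x y
  proof -
    obtain u v where "\<And>n. u n \<in> D" "u \<longlonglongrightarrow> x" "\<And>n. v n \<in> D" "v \<longlonglongrightarrow> y"
      using \<open>x \<in> closure D\<close> \<open>y \<in> closure D\<close> unfolding closure_sequential by auto
    then show ?thesis unfolding closure_sequential
      by (intro exI[of _ "\<lambda>n. u n + v n"]) (auto intro: assms(2) tendsto_add)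
  qed
  show "c *\<^sub>R x \<in> closure D" if "x \<in> closure D" for c x
  proof -
    obtain u where u: "\<And>n. u n \<in> D" "u \<longlonglongrightarrow> x"
      using \<open>x \<in> closure D\<close> unfolding closure_sequential by auto
    have "c \<in> closure \<rat>" by (simp add: Rats_closure_real)
    then obtain q where "\<And>n. q n \<in> \<rat>" "q \<longlonglongrightarrow> c" unfolding closure_sequential by auto
    then show ?thesis unfolding closure_sequential
      using u by (intro exI[of _ "\<lambda>n. q n *\<^sub>R u n"]) (auto intro: assms(3) tendsto_scaleR)
  qed
qed

lemma separable_span:
  fixes G :: "'a::real_normed_vector set"
  assumes "countable G"
  obtains D where "countable D" "closure (span G) \<subseteq> closure D"
proof -
  define D where "D = (\<lambda>l. \<Sum>(q, g)\<leftarrow>l. of_rat q *\<^sub>R g) ` lists (UNIV \<times> G)"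
  have "countable D" using assms by (auto simp: D_def)
  moreover have "span G \<subseteq> closure D"
  proof (rule span_minimal)
    have D_add: "x + y \<in> D" if "x \<in> D" "y \<in> D" for x y
    proof -
      from that obtain k l where "k \<in> lists (UNIV \<times> G)" "l \<in> lists (UNIV \<times> G)"
        "x = (\<Sum>(q, g)\<leftarrow>k. of_rat q *\<^sub>R g)" "y = (\<Sum>(q, g)\<leftarrow>l. of_rat q *\<^sub>R g)"
        by (auto simp: D_def)
      then show ?thesis unfolding D_def by (intro image_eqI[of _ _ "k @ l"]) auto
    qed
    have D_scale: "of_rat q *\<^sub>R x \<in> D" if "x \<in> D" for q x
    proof -
      from that obtain k where k: "k \<in> lists (UNIV \<times> G)" "x = (\<Sum>(q, g)\<leftarrow>k. of_rat q *\<^sub>R g)"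
        by (auto simp: D_def)
      have "of_rat q *\<^sub>R (\<Sum>(q, g)\<leftarrow>k. of_rat q *\<^sub>R g) = (\<Sum>(q, g)\<leftarrow>map (\<lambda>(p, g). (q * p, g)) k. of_rat q *\<^sub>R g)"
        for k :: "(rat \<times> 'a) list"
        by (induction k) (auto simp: scaleR_add_right of_rat_mult)
      then show ?thesis unfolding D_def
        using k by (intro image_eqI[of _ _ "map (\<lambda>(p, g). (q * p, g)) k"]) auto
    qed
    show "subspace (closure D)"
    proof (rule subspace_closureI)
      show "0 \<in> D" unfolding D_def by (intro image_eqI[of _ _ "[]"]) auto
      show "q *\<^sub>R x \<in> D" if "q \<in> \<rat>" "x \<in> D" for q x
        using that D_scale by (auto elim!: Rats_cases)
    qed (rule D_add)
    show "G \<subseteq> closure D"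
    proof
      fix g assume "g \<in> G"
      then have "g \<in> D" unfolding D_def by (intro image_eqI[of _ _ "[(1, g)]"]) auto
      then show "g \<in> closure D" using closure_subset by auto
    qed
  qed
  ultimately show ?thesis using that by (metis closure_minimal closed_closure)
qed

definition indicator_L2 :: "'a::euclidean_space set \<Rightarrow> 'b::euclidean_space \<Rightarrow> ('a, 'b) L2" where
  "indicator_L2 S b = abs_L2 (\<lambda>x. indicator S x *\<^sub>R b)"

lemma square_integrable_indicator:
  assumes "S \<in> lmeasurable"
  shows "square_integrable (\<lambda>x. indicator S x *\<^sub>R b)"
proof -
  have "integrable lebesgue (\<lambda>x. indicator S x *\<^sub>R (norm b)\<^sup>2)"
    using assms by (intro integrable_scaleR_left) (auto simp: fmeasurable_def)
  also have "(\<lambda>x. indicator S x *\<^sub>R (norm b)\<^sup>2) = (\<lambda>x. (norm (indicator S x *\<^sub>R b))\<^sup>2)"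
    by (auto simp: indicator_def)
  finally show ?thesis
    using assms by (auto simp: square_integrable_def)
qed

lemma dist_indicator_L2:
  assumes "S \<in> lmeasurable" "T \<in> lmeasurable" "S \<subseteq> T"
  shows "(dist (indicator_L2 S b) (indicator_L2 T b))\<^sup>2 = (norm b)\<^sup>2 * (measure lebesgue T - measure lebesgue S)"
proof -
  have "(dist (indicator_L2 S b) (indicator_L2 T b))\<^sup>2 = (\<integral>x. (norm (indicator S x *\<^sub>R b - indicator T x *\<^sub>R b))\<^sup>2 \<partial>lebesgue)"
    unfolding indicator_L2_def dist_norm
    using assms by (simp add: abs_L2_diff square_integrable_indicator square_integrable_diff norm_abs_L2_sq)
  also have "\<dots> = (\<integral>x. indicator (T - S) x *\<^sub>R (norm b)\<^sup>2 \<partial>lebesgue)"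
    using assms by (intro Bochner_Integration.integral_cong) (auto simp: indicator_def)
  also have "\<dots> = (norm b)\<^sup>2 * measure lebesgue (T - S)"
    using assms using fmeasurable_Diff[OF assms(2) fmeasurableD[OF assms(1)]]
    by (subst integral_scaleR_left) (auto simp: fmeasurable_def simp del: emeasure_completion)
  also have "measure lebesgue (T - S) = measure lebesgue T - measure lebesgue S"
    using assms by (simp add: measurable_measure_Diff fmeasurableD)
  finally show ?thesis .
qed

lemma L2_dense:
  obtains G :: "('a::euclidean_space, 'b::euclidean_space) L2 set"
  where "countable G" "closure (span G) = UNIV"
proof -
  obtain B :: "'a set set" where B: "countable B" "topological_basis B"
    using ex_countable_basis by blast
  define G :: "('a, 'b) L2 set" where
    "G = (\<lambda>(F, b). indicator_L2 (\<Union>F) b) ` ({F. finite F \<and> F \<subseteq> B \<and> \<Union>F \<in> lmeasurable} \<times> Basis)"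
  have "countable {F. finite F \<and> F \<subseteq> B}" using B(1) by (rule countable_Collect_finite_subset)
  then have "countable {F. finite F \<and> F \<subseteq> B \<and> \<Union>F \<in> lmeasurable}"
    by (rule countable_subset[rotated]) auto
  then have "countable G" unfolding G_def
    by (intro countable_image countable_SIGMA countable_finite[OF finite_Basis])
  define V where "V = closure (span G)"
  have V_sub: "subspace V" unfolding V_def by (intro subspace_closureI span_zero span_add span_scale)
  have V_closed: "closed V" by (simp add: V_def)
  have V_open: "indicator_L2 U b \<in> V" if U: "open U" "U \<in> lmeasurable" and b: "b \<in> Basis" for U b
  proof -
    obtain \<C> where \<C>: "\<C> \<subseteq> B" "U = \<Union>\<C>" using B(2) U(1) by (metis topological_basis)
    define C where "C = from_nat_into (insert {} \<C>)"
    have cC: "countable (insert {} \<C>)" using \<C>(1) B(1) by (auto intro: countable_subset)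
    then have C: "range C = insert {} \<C>" unfolding C_def by (rule range_from_nat_into[rotated]) simp
    define F where "F n = C ` {..<n} - {{}}" for n :: nat
    have F: "finite (F n)" "F n \<subseteq> \<C>" for n using C by (auto simp: F_def)
    have F_open: "open (\<Union>(F n))" for n
      using F(2)[of n] \<C>(1) B(2) by (auto intro!: open_Union topological_basis_open)
    have F_lm: "\<Union>(F n) \<in> lmeasurable" for n
    proof (rule fmeasurableI2[OF U(2)])
      show "\<Union>(F n) \<subseteq> U" using F(2) \<C>(2) by blast
      show "\<Union>(F n) \<in> sets lebesgue" using F_open by (simp add: borel_open)
    qed
    have U_eq: "(\<Union>n. \<Union>(F n)) = U"
    proof
      show "(\<Union>n. \<Union>(F n)) \<subseteq> U" using F(2) \<C>(2) by blast
      show "U \<subseteq> (\<Union>n. \<Union>(F n))"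
      proof
        fix x assume "x \<in> U"
        then obtain W where W: "W \<in> \<C>" "x \<in> W" using \<C>(2) by auto
        then have "W \<in> range C" using C by simp
        then obtain n where "W = C n" by blast
        then have "W \<in> F (Suc n)" using W by (auto simp: F_def)
        then show "x \<in> (\<Union>n. \<Union>(F n))" using W by blast
      qed
    qed
    have "(\<lambda>n. measure lebesgue (\<Union>(F n))) \<longlonglongrightarrow> measure lebesgue (\<Union>n. \<Union>(F n))"
    proof (rule Lim_measure_incseq)
      show "range (\<lambda>n. \<Union>(F n)) \<subseteq> sets lebesgue" using F_lm by auto
      show "incseq (\<lambda>n. \<Union>(F n))" unfolding incseq_def F_def by (fastforce)
      show "emeasure lebesgue (\<Union>n. \<Union>(F n)) \<noteq> \<infinity>" using U(2) unfolding U_eq by (auto simp: fmeasurable_def)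
    qed
    then have "(\<lambda>n. (norm b)\<^sup>2 * (measure lebesgue U - measure lebesgue (\<Union>(F n)))) \<longlonglongrightarrow> (norm b)\<^sup>2 * (measure lebesgue U - measure lebesgue U)"
      unfolding U_eq by (intro tendsto_intros)
    moreover have "(norm b)\<^sup>2 * (measure lebesgue U - measure lebesgue (\<Union>(F n))) = (dist (indicator_L2 (\<Union>(F n)) b) (indicator_L2 U b))\<^sup>2" for n
      using F_lm U(2) U_eq by (subst dist_indicator_L2) auto
    ultimately have "(\<lambda>n. (dist (indicator_L2 (\<Union>(F n)) b) (indicator_L2 U b))\<^sup>2) \<longlonglongrightarrow> 0" by simp
    then have "(\<lambda>n. sqrt ((dist (indicator_L2 (\<Union>(F n)) b) (indicator_L2 U b))\<^sup>2)) \<longlonglongrightarrow> sqrt 0" by (rule tendsto_real_sqrt)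
    then have "(\<lambda>n. indicator_L2 (\<Union>(F n)) b) \<longlonglongrightarrow> indicator_L2 U b" by (subst tendsto_dist_iff) simp
    moreover have "indicator_L2 (\<Union>(F n)) b \<in> V" for n
    proof -
      have "F n \<subseteq> B" using F(2)[of n] \<C>(1) by blast
      then have "indicator_L2 (\<Union>(F n)) b \<in> G" unfolding G_def
        using F(1)[of n] F_lm[of n] b by (intro image_eqI[of _ _ "(F n, b)"]) auto
      then show ?thesis unfolding V_def by (meson closure_subset span_base subsetD)
    qed
    ultimately show ?thesis using V_closed by (meson closed_sequentially)
  qed
  have V_lm: "indicator_L2 S b \<in> V" if S: "S \<in> lmeasurable" and b: "b \<in> Basis" for S b
  proof -
    have "\<exists>y\<in>V. dist y (indicator_L2 S b) < e" if "e > 0" for e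
    proof -
      have "0 < e\<^sup>2" using that by simp
      then obtain U where U: "open U" "S \<subseteq> U" "U - S \<in> lmeasurable" "emeasure lebesgue (U - S) < ennreal (e\<^sup>2)"
        using sets_lebesgue_outer_open[of S "e\<^sup>2"] S by (auto simp: fmeasurableD)
      have "U = S \<union> (U - S)" using U(2) by auto
      then have U_lm: "U \<in> lmeasurable" using S U(3) by (metis fmeasurable.Un)
      have "measure lebesgue (U - S) < e\<^sup>2"
        using U(3,4) by (simp add: emeasure_eq_measure2 ennreal_less_iff)
      then have "(dist (indicator_L2 S b) (indicator_L2 U b))\<^sup>2 < e\<^sup>2"
        using S U U_lm b by (simp add: dist_indicator_L2 measurable_measure_Diff fmeasurableD)
      then have "dist (indicator_L2 U b) (indicator_L2 S b) < e"
        using that by (metis dist_commute less_imp_le power2_less_imp_less)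
      then show ?thesis using V_open[OF U(1) U_lm b] by blast
    qed
    then have "indicator_L2 S b \<in> closure V" by (simp add: closure_approachable)
    then show ?thesis using V_closed by simp
  qed
  have V_sum: "square_integrable (\<lambda>x. \<Sum>i\<in>I. f i x) \<and> abs_L2 (\<lambda>x. \<Sum>i\<in>I. f i x) \<in> V"
    if "finite I" "\<And>i. i \<in> I \<Longrightarrow> square_integrable (f i) \<and> abs_L2 (f i) \<in> V"
    for I :: "'i set" and f :: "'i \<Rightarrow> 'a \<Rightarrow> 'b"
    using that
  proof (induction I rule: finite_induct)
    case empty
    have "abs_L2 (\<lambda>_. 0) = (0 :: ('a, 'b) L2)" by (simp add: zero_L2_def)
    then show ?case using subspace_0[OF V_sub] by (simp add: square_integrable_zero)
  next
    case (insert i I)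
    then show ?case
      by (simp add: square_integrable_add abs_L2_add[symmetric] subspace_add[OF V_sub])
  qed
  have V_ind: "square_integrable (\<lambda>x. indicator S x *\<^sub>R y) \<and> abs_L2 (\<lambda>x. indicator S x *\<^sub>R y) \<in> V"
    if S: "S \<in> lmeasurable" for S y
  proof -
    have "square_integrable (\<lambda>x. \<Sum>b\<in>Basis. (y \<bullet> b) *\<^sub>R indicator S x *\<^sub>R b) \<and>
        abs_L2 (\<lambda>x. \<Sum>b\<in>Basis. (y \<bullet> b) *\<^sub>R indicator S x *\<^sub>R b) \<in> V"
    proof (rule V_sum)
      fix b :: 'b assume "b \<in> Basis"
      then show "square_integrable (\<lambda>x. (y \<bullet> b) *\<^sub>R indicator S x *\<^sub>R b) \<and>
          abs_L2 (\<lambda>x. (y \<bullet> b) *\<^sub>R indicator S x *\<^sub>R b) \<in> V"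
        using V_lm[OF S, of b] subspace_scale[OF V_sub, of "indicator_L2 S b" "y \<bullet> b"] square_integrable_indicator[OF S, of b]
          square_integrable_scaleR[OF square_integrable_indicator[OF S, of b], of "y \<bullet> b"]
        by (auto simp: indicator_L2_def abs_L2_scaleR)
    qed simp
    moreover have "(\<Sum>b\<in>Basis. (y \<bullet> b) *\<^sub>R indicator S x *\<^sub>R b) = indicator S x *\<^sub>R y" for x
      by (auto simp: indicator_def euclidean_representation)
    ultimately show ?thesis by simp
  qed
  have V_simple: "square_integrable s \<and> abs_L2 s \<in> V"
    if s: "simple_function lebesgue s" and f: "square_integrable f" and le: "\<And>x. norm (s x) \<le> 2 * norm (f x)"
    for s f :: "'a \<Rightarrow> 'b"
  proof -
    have s_meas: "s \<in> borel_measurable lebesgue" using s by (rule borel_measurable_simple_function)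
    have s_eq: "s = (\<lambda>x. \<Sum>y\<in>range s - {0}. indicator (s -` {y}) x *\<^sub>R y)"
    proof
      fix x
      have "finite (range s)" using s by (simp add: simple_function_def)
      then have "(\<Sum>y\<in>range s - {0}. indicator (s -` {y}) x *\<^sub>R y) = (\<Sum>y\<in>range s - {0}. if y = s x then y else 0)"
        by (intro sum.cong) (auto simp: indicator_def)
      also have "\<dots> = s x" using \<open>finite (range s)\<close> by (subst sum.delta) auto
      finally show "s x = (\<Sum>y\<in>range s - {0}. indicator (s -` {y}) x *\<^sub>R y)" by simp
    qed
    have "square_integrable (\<lambda>x. \<Sum>y\<in>range s - {0}. indicator (s -` {y}) x *\<^sub>R y) \<and>
      abs_L2 (\<lambda>x. \<Sum>y\<in>range s - {0}. indicator (s -` {y}) x *\<^sub>R y) \<in> V"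
    proof (intro V_sum V_ind)
      show "finite (range s - {0})" using s by (simp add: simple_function_def)
      fix y assume y: "y \<in> range s - {0}"
      have meas: "s -` {y} \<in> sets lebesgue" using s_meas measurable_sets[of s lebesgue borel "{y}"] by simp
      have "integrable lebesgue (\<lambda>x. 4 / (norm y)\<^sup>2 * (norm (f x))\<^sup>2)"
        using f by (auto simp: square_integrable_def)
      then have "integrable lebesgue (indicator (s -` {y}) :: 'a \<Rightarrow> real)"
      proof (rule Bochner_Integration.integrable_bound)
        show "indicator (s -` {y}) \<in> borel_measurable lebesgue" using meas by simp
        show "AE x in lebesgue. norm (indicator (s -` {y}) x :: real) \<le> norm (4 / (norm y)\<^sup>2 * (norm (f x))\<^sup>2)"
        proof (rule AE_I2)
          fix x
          have "(norm (s x))\<^sup>2 \<le> (2 * norm (f x))\<^sup>2" using le[of x] by (intro power_mono) auto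
          then show "norm (indicator (s -` {y}) x :: real) \<le> norm (4 / (norm y)\<^sup>2 * (norm (f x))\<^sup>2)"
            using y by (auto simp: indicator_def field_simps power_mult_distrib)
        qed
      qed
      then show "s -` {y} \<in> lmeasurable"
        using meas by (simp add: integrable_indicator_iff fmeasurable_def)
    qed
    then show ?thesis using s_eq by simp
  qed
  have "h \<in> V" for h
  proof -
    define f where "f = rep_L2 h"
    have f: "square_integrable f" and h: "h = abs_L2 f" by (simp_all add: f_def rep_L2 abs_rep_L2)
    have f_meas [measurable]: "f \<in> borel_measurable lebesgue" using f by (simp add: square_integrable_def)
    obtain s where s: "\<And>i. simple_function lebesgue (s i)" "\<And>x. (\<lambda>i. s i x) \<longlonglongrightarrow> f x"
      "\<And>i x. norm (s i x) \<le> 2 * norm (f x)"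
      using borel_measurable_implies_sequence_metric[OF f_meas, of 0] by auto
    have sV: "square_integrable (s i)" "abs_L2 (s i) \<in> V" for i
      using V_simple[OF s(1) f s(3)] by blast+
    have [measurable]: "s i \<in> borel_measurable lebesgue" for i using s(1) by (rule borel_measurable_simple_function)
    have "(\<lambda>i. \<integral>x. (norm (s i x - f x))\<^sup>2 \<partial>lebesgue) \<longlonglongrightarrow> (\<integral>x. 0 \<partial>(lebesgue :: 'a measure))"
    proof (rule integral_dominated_convergence[where w = "\<lambda>x. 9 * (norm (f x))\<^sup>2"])
      show "integrable lebesgue (\<lambda>x. 9 * (norm (f x))\<^sup>2)" using f by (auto simp: square_integrable_def)
      show "AE x in lebesgue. (\<lambda>i. (norm (s i x - f x))\<^sup>2) \<longlonglongrightarrow> 0"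
      proof (rule AE_I2)
        fix x
        have "(\<lambda>i. (norm (s i x - f x))\<^sup>2) \<longlonglongrightarrow> (norm (f x - f x))\<^sup>2"
          using s(2) by (intro tendsto_intros)
        then show "(\<lambda>i. (norm (s i x - f x))\<^sup>2) \<longlonglongrightarrow> 0" by simp
      qed
      show "AE x in lebesgue. norm ((norm (s i x - f x))\<^sup>2) \<le> 9 * (norm (f x))\<^sup>2" for i
      proof (rule AE_I2)
        fix x
        have "norm (s i x - f x) \<le> 3 * norm (f x)"
          using norm_triangle_ineq4[of "s i x" "f x"] s(3)[of i x] by linarith
        then have "(norm (s i x - f x))\<^sup>2 \<le> (3 * norm (f x))\<^sup>2" by (intro power_mono) auto
        then show "norm ((norm (s i x - f x))\<^sup>2) \<le> 9 * (norm (f x))\<^sup>2" by (simp add: power_mult_distrib)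
      qed
    qed auto
    moreover have "(\<integral>x. (norm (s i x - f x))\<^sup>2 \<partial>lebesgue) = (dist (abs_L2 (s i)) h)\<^sup>2" for i
      unfolding h dist_norm by (simp add: abs_L2_diff sV f norm_abs_L2_sq square_integrable_diff)
    ultimately have "(\<lambda>i. (dist (abs_L2 (s i)) h)\<^sup>2) \<longlonglongrightarrow> 0" by simp
    then have "(\<lambda>i. sqrt ((dist (abs_L2 (s i)) h)\<^sup>2)) \<longlonglongrightarrow> sqrt 0" by (rule tendsto_real_sqrt)
    then have "(\<lambda>i. abs_L2 (s i)) \<longlonglongrightarrow> h" by (subst tendsto_dist_iff) simp
    then show ?thesis using V_closed sV by (meson closed_sequentially)
  qed
  then have "closure (span G) = UNIV" unfolding V_def by blast
  with \<open>countable G\<close> show ?thesis by (rule that)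
qed

instance L2 :: (euclidean_space, euclidean_space) second_countable_topology
proof
  obtain G :: "('a, 'b) L2 set" where G: "countable G" "closure (span G) = UNIV" by (rule L2_dense)
  obtain D :: "('a, 'b) L2 set" where "countable D" "closure (span G) \<subseteq> closure D"
    using separable_span[OF G(1)] by blast
  then show "\<exists>B :: ('a, 'b) L2 set set. countable B \<and> open = generate_topology B"
    using G(2) by (intro separable_imp_countable_basis[of D]) auto
qed

section \<open>Lebesgue and Sobolev spaces on a domain\<close>

text \<open>\<open>L\<^sup>2(\<Omega>)\<close> is the closed subspace of the functions that vanish outside \<open>\<Omega>\<close>
  (extension by zero), so its inner product and norm are those of the type. The class
  \<open>to_L2 \<Omega> f\<close> is meaningful only if \<open>f\<close> is square-integrable over \<open>\<Omega>\<close>; values of \<open>f\<close> outside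
  \<open>\<Omega>\<close> are ignored.\<close>

definition L2_on :: "'a::euclidean_space set \<Rightarrow> ('a, 'b::euclidean_space) L2 set" where
  "L2_on \<Omega> = {u. AE x in lebesgue. x \<notin> \<Omega> \<longrightarrow> rep_L2 u x = 0}"

definition to_L2 :: "'a::euclidean_space set \<Rightarrow> ('a \<Rightarrow> 'b::euclidean_space) \<Rightarrow> ('a, 'b) L2" where
  "to_L2 \<Omega> f = abs_L2 (\<lambda>x. indicator \<Omega> x *\<^sub>R f x)"

definition mult_L2 ::
    "'a::euclidean_space set \<Rightarrow> ('a \<Rightarrow> real) \<Rightarrow> ('a, 'b::euclidean_space) L2 \<Rightarrow> ('a, 'b) L2" where
  "mult_L2 \<Omega> a u = to_L2 \<Omega> (\<lambda>x. a x *\<^sub>R rep_L2 u x)"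

definition Linfty_on :: "'a::euclidean_space set \<Rightarrow> ('a \<Rightarrow> real) set" where
  "Linfty_on \<Omega> = {c. c \<in> borel_measurable (lebesgue_on \<Omega>) \<and>
     (\<exists>M. AE x in lebesgue_on \<Omega>. \<bar>c x\<bar> \<le> M)}"

primrec C_k :: "nat \<Rightarrow> ('a::euclidean_space \<Rightarrow> real) \<Rightarrow> bool" where
  "C_k 0 f \<longleftrightarrow> continuous_on UNIV f"
| "C_k (Suc k) f \<longleftrightarrow> (\<forall>x. f differentiable (at x)) \<and>
     (\<forall>b\<in>Basis. C_k k (\<lambda>x. frechet_derivative f (at x) b))"

definition test_functions :: "'a::euclidean_space set \<Rightarrow> ('a \<Rightarrow> real) set" where
  "test_functions S = {\<phi>. (\<forall>k. C_k k \<phi>) \<and>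
     compact (closure {x. \<phi> x \<noteq> 0}) \<and> closure {x. \<phi> x \<noteq> 0} \<subseteq> S}"

definition classical_gradient :: "('a::euclidean_space \<Rightarrow> real) \<Rightarrow> 'a \<Rightarrow> 'a" where
  "classical_gradient \<phi> x = (\<Sum>b\<in>Basis. frechet_derivative \<phi> (at x) b *\<^sub>R b)"

definition has_weak_gradient ::
    "'a::euclidean_space set \<Rightarrow> ('a, real) L2 \<Rightarrow> ('a, 'a) L2 \<Rightarrow> bool" where
  "has_weak_gradient \<Omega> u g \<longleftrightarrow> u \<in> L2_on \<Omega> \<and> g \<in> L2_on \<Omega> \<and>
     (\<forall>\<phi>\<in>test_functions \<Omega>. \<forall>b\<in>Basis.
        (LINT x|lebesgue_on \<Omega>. rep_L2 u x * frechet_derivative \<phi> (at x) b) =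
        - (LINT x|lebesgue_on \<Omega>. (rep_L2 g x \<bullet> b) * \<phi> x))"

definition weak_gradient :: "'a::euclidean_space set \<Rightarrow> ('a, real) L2 \<Rightarrow> ('a, 'a) L2" where
  "weak_gradient \<Omega> u = (THE g. has_weak_gradient \<Omega> u g)"

text \<open>Sobolev functions are represented by the pair \<open>(u, \<nabla>u)\<close>: the product norm
  \<open>sqrt ((norm u)\<^sup>2 + (norm (\<nabla>u))\<^sup>2)\<close> is then the norm of \<open>H\<^sup>1(\<Omega>)\<close>, and \<open>H\<^sup>1\<^sub>0(\<Omega>)\<close> is the closure
  of the test functions in this norm.\<close>

definition H1_graph :: "'a::euclidean_space set \<Rightarrow> (('a, real) L2 \<times> ('a, 'a) L2) set" where
  "H1_graph \<Omega> = {(u, g). has_weak_gradient \<Omega> u g}"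

definition H10_graph :: "'a::euclidean_space set \<Rightarrow> (('a, real) L2 \<times> ('a, 'a) L2) set" where
  "H10_graph \<Omega> = H1_graph \<Omega> \<inter>
     closure ((\<lambda>\<phi>. (to_L2 \<Omega> \<phi>, to_L2 \<Omega> (classical_gradient \<phi>))) ` test_functions \<Omega>)"

text \<open>In the local condition, \<open>x - (x \<bullet> e) *\<^sub>R e\<close> and \<open>x \<bullet> e\<close> are the horizontal and the vertical
  coordinates of \<open>x\<close> in a rotated frame with vertical axis \<open>e\<close>.\<close>

definition bounded_lipschitz_domain :: "'a::euclidean_space set \<Rightarrow> bool" where
  "bounded_lipschitz_domain \<Omega> \<longleftrightarrow> open \<Omega> \<and> connected \<Omega> \<and> \<Omega> \<noteq> {} \<and> bounded \<Omega> \<and>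
     (\<forall>p\<in>frontier \<Omega>. \<exists>r>0. \<exists>e L \<gamma>. norm e = 1 \<and> L-lipschitz_on {y. y \<bullet> e = 0} \<gamma> \<and>
        \<Omega> \<inter> ball p r = {x \<in> ball p r. x \<bullet> e > \<gamma> (x - (x \<bullet> e) *\<^sub>R e)})"

section \<open>Bochner spaces on a time interval\<close>

text \<open>\<open>X\<close> is a closed subspace of the Banach space. As usual, elements are given by
  representatives, of which only the values on \<open>{0<..<T}\<close> matter.\<close>

definition bochner_L2 :: "real \<Rightarrow> 'a::{banach, second_countable_topology} set \<Rightarrow> (real \<Rightarrow> 'a) set" where
  "bochner_L2 T X = {u. u \<in> borel_measurable (lebesgue_on {0<..<T}) \<and>
     (AE t in lebesgue_on {0<..<T}. u t \<in> X) \<and>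
     integrable (lebesgue_on {0<..<T}) (\<lambda>t. (norm (u t))\<^sup>2)}"

definition has_weak_time_deriv ::
    "real \<Rightarrow> (real \<Rightarrow> 'a::{banach, second_countable_topology}) \<Rightarrow> (real \<Rightarrow> 'a) \<Rightarrow> bool" where
  "has_weak_time_deriv T u v \<longleftrightarrow>
     integrable (lebesgue_on {0<..<T}) u \<and> integrable (lebesgue_on {0<..<T}) v \<and>
     (\<forall>\<phi>\<in>test_functions {0<..<T}.
        (LINT t|lebesgue_on {0<..<T}. deriv \<phi> t *\<^sub>R u t) =
        - (LINT t|lebesgue_on {0<..<T}. \<phi> t *\<^sub>R v t))"

text \<open>The choice only affects a null set of times.\<close>

definition weak_time_deriv ::
    "real \<Rightarrow> (real \<Rightarrow> 'a::{banach, second_countable_topology}) \<Rightarrow> (real \<Rightarrow> 'a)" where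
  "weak_time_deriv T u = (SOME v. has_weak_time_deriv T u v)"

text \<open>Point evaluation \<open>u(\<cdot>, s)\<close>, through the representative that is continuous on \<open>{0..T}\<close>.\<close>

definition time_trace :: "real \<Rightarrow> (real \<Rightarrow> 'a::topological_space) \<Rightarrow> real \<Rightarrow> 'a" where
  "time_trace T u s = (THE x. \<exists>w. continuous_on {0..T} w \<and>
     (AE t in lebesgue_on {0<..<T}. u t = w t) \<and> w s = x)"

definition bochner_H1 :: "real \<Rightarrow> 'a::{banach, second_countable_topology} set \<Rightarrow> (real \<Rightarrow> 'a) set" where
  "bochner_H1 T X = {u \<in> bochner_L2 T X. \<exists>v\<in>bochner_L2 T X. has_weak_time_deriv T u v}"

definition bochner_H2 :: "real \<Rightarrow> 'a::{banach, second_countable_topology} set \<Rightarrow> (real \<Rightarrow> 'a) set" where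
  "bochner_H2 T X = {u \<in> bochner_L2 T X. \<exists>v\<in>bochner_L2 T X. \<exists>w\<in>bochner_L2 T X.
     has_weak_time_deriv T u v \<and> has_weak_time_deriv T v w}"

definition bochner_H2_0 :: "real \<Rightarrow> 'a::{banach, second_countable_topology} set \<Rightarrow> (real \<Rightarrow> 'a) set" where
  "bochner_H2_0 T X = {u \<in> bochner_H2 T X. time_trace T u 0 = 0}"

definition bochner_H1_H10 ::
    "real \<Rightarrow> 'a::euclidean_space set \<Rightarrow> (real \<Rightarrow> ('a, real) L2) set" where
  "bochner_H1_H10 T \<Omega> = {u. (\<lambda>t. (u t, weak_gradient \<Omega> (u t))) \<in> bochner_H1 T (H10_graph \<Omega>)}"

section \<open>The bilinear form, the operator and the energy norm\<close>

text \<open>\<open>L\<^sup>2(Q\<^sub>T)\<close> is identified with \<open>L\<^sup>2(0,T;L\<^sup>2(\<Omega>))\<close>: its inner product is the integral over time of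
  the inner product in space.\<close>

definition wave_form ::
    "'a::euclidean_space set \<Rightarrow> real \<Rightarrow> ('a \<Rightarrow> real) \<Rightarrow>
      (real \<Rightarrow> ('a, real) L2) \<Rightarrow> (real \<Rightarrow> ('a, real) L2) \<Rightarrow> real" where
  "wave_form \<Omega> T c U W =
     (LINT t|lebesgue_on {0<..<T}.
        weak_time_deriv T (weak_time_deriv T U) t \<bullet> weak_time_deriv T W t) +
     time_trace T (weak_time_deriv T U) 0 \<bullet> time_trace T (weak_time_deriv T W) 0 +
     (LINT t|lebesgue_on {0<..<T}.
        mult_L2 \<Omega> (\<lambda>x. (c x)\<^sup>2) (weak_gradient \<Omega> (U t)) \<bullet>
        weak_gradient \<Omega> (weak_time_deriv T W t))"

definition exp_weight_op ::
    "real \<Rightarrow> (real \<Rightarrow> ('a::euclidean_space, real) L2) \<Rightarrow> real \<Rightarrow> ('a, real) L2" where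
  "exp_weight_op T W t = (LINT s|lebesgue_on {0<..<t}. exp (- s / T) *\<^sub>R weak_time_deriv T W s)"

definition energy_norm ::
    "'a::euclidean_space set \<Rightarrow> real \<Rightarrow> ('a \<Rightarrow> real) \<Rightarrow> (real \<Rightarrow> ('a, real) L2) \<Rightarrow> real" where
  "energy_norm \<Omega> T c U = sqrt (
     (LINT t|lebesgue_on {0<..<T}. (norm (weak_time_deriv T U t))\<^sup>2) +
     (LINT t|lebesgue_on {0<..<T}. (norm (mult_L2 \<Omega> c (weak_gradient \<Omega> (U t))))\<^sup>2))"

end

theory Submission
  imports Defs
begin

text \<open>Write \<open>V = \<partial>\<^sub>tU\<close>, \<open>G = \<nabla>U\<close>, so that the test function \<open>W = \<L>\<^sub>TU\<close> has \<open>\<partial>\<^sub>tW = e\<^bsup>-t/T\<^esup> V\<close>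
  and \<open>\<nabla>\<partial>\<^sub>tW = e\<^bsup>-t/T\<^esup> \<partial>\<^sub>tG\<close>. Hence both integrals in the form are of the shape
  \<open>\<integral> e\<^bsup>-t/T\<^esup> (P', P) dt\<close> with \<open>P = V\<close> or \<open>P = c G\<close>, and integration by parts against
  \<open>(P', P) = \<partial>\<^sub>t |P|\<^sup>2 / 2\<close> gives
  \<open>e\<^sup>-\<^sup>1 |P(T)|\<^sup>2 / 2 - |P(0)|\<^sup>2 / 2 + (1 / 2T) \<integral> e\<^bsup>-t/T\<^esup> |P|\<^sup>2 dt\<close>, where \<open>e\<^bsup>-t/T\<^esup> \<ge> e\<^sup>-\<^sup>1\<close>. The boundary
  term at 0 is absorbed by the trace term of the form for \<open>P = V\<close>; for \<open>P = c G\<close> it vanishes, because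
  \<open>U(0) = 0\<close>, the graph of the weak gradient is closed and the weak gradient is unique.\<close>

section \<open>Smooth test functions\<close>

text \<open>The decay rate of the weight explains the constant. With \<psi>(t) = exp (- r t) the
  same computation gives the factor r exp (- r T) / 2, because - \<psi>' / 2 = r \<psi> / 2 is
  bounded below by its value at T; this factor is largest at r = 1 / T, where it equals 1 / (2 e T).
  The main obstacle is that nothing is known at individual times. U is an almost everywhere class,
  its derivatives come from choice operators, and the values at 0 are traces. Hence every weak
  derivative is first turned into a Bochner integral, whose indefinite integral is a continuous
  representative. Integration by parts is proved for such indefinite integrals by comparing
  increments over short intervals, so it never differentiates a function at a point. Exchanging the
  gradient and the time derivative is built into the pair (U, \<nabla>U): its weak derivative takes
  values in the graph of the gradient, so its second component is the gradient of its first.\<close>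

lemma C_k_SucI:
  assumes "\<And>x. (f has_derivative f' x) (at x)" and "\<And>b. b \<in> Basis \<Longrightarrow> C_k k (\<lambda>x. f' x b)"
  shows "C_k (Suc k) f"
proof -
  have "frechet_derivative f (at x) = f' x" for x
    using frechet_derivative_at[OF assms(1)] by simp
  then show ?thesis using assms by (auto simp: differentiable_def)
qed

lemma C_k_SucD:
  assumes "C_k (Suc k) f"
  shows "(f has_derivative frechet_derivative f (at x)) (at x)"
    and "b \<in> Basis \<Longrightarrow> C_k k (\<lambda>x. frechet_derivative f (at x) b)"
  using assms by (auto simp: frechet_derivative_works)

lemma C_k_Suc_imp: "C_k (Suc k) f \<Longrightarrow> C_k k f"
proof (induction k arbitrary: f)
  case 0
  then show ?case
    by (auto intro!: continuous_at_imp_continuous_on differentiable_imp_continuous_within)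
next
  case (Suc k)
  show ?case
    by (rule C_k_SucI[OF C_k_SucD(1)[OF Suc.prems]]) (blast intro: Suc.IH C_k_SucD(2)[OF Suc.prems])
qed

lemma C_k_const: "C_k k (\<lambda>_. r)"
proof (induction k arbitrary: r)
  case (Suc k)
  show ?case by (rule C_k_SucI[where f' = "\<lambda>_ _. 0"]) (auto intro: Suc)
qed simp

lemma C_k_add: "C_k k f \<Longrightarrow> C_k k g \<Longrightarrow> C_k k (\<lambda>x. f x + g x)"
proof (induction k arbitrary: f g)
  case (Suc k)
  show ?case
    by (rule C_k_SucI[OF has_derivative_add[OF C_k_SucD(1)[OF Suc.prems(1)] C_k_SucD(1)[OF Suc.prems(2)]]])
      (intro Suc.IH C_k_SucD(2)[OF Suc.prems(1)] C_k_SucD(2)[OF Suc.prems(2)])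
qed (auto intro!: continuous_on_add continuous_on_mult)

text \<open>The product rule leaves undifferentiated factors, known at order \<open>Suc k\<close>;
  \<open>C_k_Suc_imp\<close> lowers them to the order \<open>k\<close> of the induction
  hypothesis.\<close>

lemma C_k_mult: "C_k k f \<Longrightarrow> C_k k g \<Longrightarrow> C_k k (\<lambda>x. f x * g x)"
proof (induction k arbitrary: f g)
  case (Suc k)
  show ?case
    by (rule C_k_SucI[OF has_derivative_mult[OF C_k_SucD(1)[OF Suc.prems(1)] C_k_SucD(1)[OF Suc.prems(2)]]])
      (intro C_k_add Suc.IH Suc.prems[THEN C_k_Suc_imp] C_k_SucD(2)[OF Suc.prems(1)] C_k_SucD(2)[OF Suc.prems(2)])
qed (auto intro!: continuous_on_add continuous_on_mult)

lemma C_k_prod: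
  "finite I \<Longrightarrow> (\<And>i. i \<in> I \<Longrightarrow> C_k k (f i)) \<Longrightarrow> C_k k (\<lambda>x. \<Prod>i\<in>I. f i x)"
  by (induction I rule: finite_induct) (auto intro: C_k_const C_k_mult)

lemma C_k_SucI_real:
  assumes "\<And>x. (f has_real_derivative f' x) (at x)" and "C_k k f'"
  shows "C_k (Suc k) f"
  by (rule C_k_SucI[where f' = "\<lambda>x h. f' x * h"]) (use assms in \<open>auto simp: has_field_derivative_def\<close>)

text \<open>Links the two notions of derivative in use: \<open>C_k\<close> is phrased with
  \<open>frechet_derivative\<close>, weak time derivatives with \<open>deriv\<close>.\<close>

lemma frechet_derivative_eq_deriv:
  fixes f :: "real \<Rightarrow> real"
  assumes "f differentiable (at x)"
  shows "frechet_derivative f (at x) h = deriv f x * h"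
proof -
  obtain D where D: "(f has_real_derivative D) (at x)"
    using assms by (auto simp: real_differentiable_def)
  then have "(f has_derivative (\<lambda>h. D * h)) (at x)" by (simp add: has_field_derivative_def)
  then show ?thesis using frechet_derivative_at DERIV_imp_deriv[OF D] by metis
qed

text \<open>For an affine inner map the derivative is a constant multiple of \<open>deriv g\<close>
  composed with the same map, so the induction stays within one family and needs no general chain
  rule.\<close>

lemma C_k_affine:
  fixes g :: "real \<Rightarrow> real" and v :: "'a::euclidean_space"
  assumes "C_k k g"
  shows "C_k k (\<lambda>x. g (x \<bullet> v + r))"
  using assms
proof (induction k arbitrary: g)
  case 0
  then have "continuous_on UNIV g" by simp
  then show ?case
    by (auto intro!: continuous_on_compose2[of UNIV g] continuous_intros)
next
  case (Suc k)
  have g: "(g has_real_derivative deriv g y) (at y)" for y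
    using Suc.prems by (simp add: DERIV_deriv_iff_real_differentiable)
  have "((\<lambda>x. g (x \<bullet> v + r)) has_derivative (\<lambda>h. deriv g (x \<bullet> v + r) * (h \<bullet> v))) (at x)" for x
  proof -
    have "((\<lambda>x. x \<bullet> v + r) has_derivative (\<lambda>h. h \<bullet> v)) (at x)"
      by (auto intro!: derivative_eq_intros)
    then show ?thesis
      using has_derivative_compose[of _ _ x UNIV g "\<lambda>h. deriv g (x \<bullet> v + r) * h"] g
      by (simp add: has_field_derivative_def)
  qed
  moreover have "C_k k (deriv g)"
    using C_k_SucD(2)[OF Suc.prems, of 1] Suc.prems by (simp add: frechet_derivative_eq_deriv)
  ultimately show ?case
    by (intro C_k_SucI[where f' = "\<lambda>x h. deriv g (x \<bullet> v + r) * (h \<bullet> v)"] C_k_mult C_k_const Suc.IH)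
qed

text \<open>The functions \<open>p (1 / s) exp (- 1 / s)\<close> with \<open>p\<close> a polynomial, extended by 0 to \<open>s \<le> 0\<close>: this
  family is closed under differentiation.\<close>

definition exp_flat :: "real poly \<Rightarrow> real \<Rightarrow> real" where
  "exp_flat p s = (if s > 0 then poly p (1 / s) * exp (- (1 / s)) else 0)"

lemma tendsto_poly_exp_0: "((\<lambda>y. poly p y * exp (- y)) \<longlongrightarrow> 0) at_top" for p :: "real poly"
proof -
  have "((\<lambda>y. \<Sum>i\<le>degree p. coeff p i * (y ^ i / exp y)) \<longlongrightarrow> (\<Sum>i\<le>degree p. coeff p i * 0)) at_top"
    by (intro tendsto_sum tendsto_mult tendsto_const tendsto_power_div_exp_0)
  then show ?thesis by (simp add: poly_altdef exp_minus sum_distrib_right divide_inverse mult.assoc)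
qed

lemma exp_flat_tendsto_0: "(exp_flat p \<longlongrightarrow> 0) (at 0)"
proof -
  have "((\<lambda>s. poly p (inverse s) * exp (- inverse s)) \<longlongrightarrow> 0) (at_right 0)"
    by (rule filterlim_compose[OF tendsto_poly_exp_0 filterlim_inverse_at_top_right])
  then have "(exp_flat p \<longlongrightarrow> 0) (at_right 0)"
    by (rule Lim_transform_eventually)
      (auto simp: exp_flat_def eventually_at_right_less eventually_at_filter inverse_eq_divide)
  moreover have "(exp_flat p \<longlongrightarrow> 0) (at_left 0)"
    by (rule tendsto_eventually) (auto simp: exp_flat_def eventually_at_filter)
  ultimately show ?thesis by (simp add: filterlim_split_at)
qed

text \<open>With y = 1 / s the derivative of p(y) exp (- y) with respect to s is (p(y) - p'(y)) y^2
  exp (- y); \<open>[:0, 0, 1:]\<close> is the factor y^2.\<close>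

lemma DERIV_exp_flat:
  "(exp_flat p has_real_derivative exp_flat ((p - pderiv p) * [:0, 0, 1:]) s) (at s)"
proof -
  consider "s > 0" | "s < 0" | "s = 0" by linarith
  then show ?thesis
  proof cases
    case 1
    have "((\<lambda>s. poly p (1 / s) * exp (- (1 / s))) has_real_derivative
        exp_flat ((p - pderiv p) * [:0, 0, 1:]) s) (at s)"
      using 1 by (auto intro!: derivative_eq_intros poly_DERIV
          simp: exp_flat_def field_simps power2_eq_square)
    moreover have "\<forall>\<^sub>F x in nhds s. poly p (1 / x) * exp (- (1 / x)) = exp_flat p x"
      using eventually_nhds_in_open[of "{0<..}" s] 1 by (auto elim!: eventually_mono simp: exp_flat_def)
    ultimately show ?thesis
      by (rule DERIV_cong_ev[OF refl _ refl, THEN iffD1, rotated])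
  next
    case 2
    have "\<forall>\<^sub>F x in nhds s. exp_flat p x = 0"
      using eventually_nhds_in_open[of "{..<0}" s] 2 by (auto elim!: eventually_mono simp: exp_flat_def)
    moreover have "((\<lambda>_. 0) has_real_derivative exp_flat ((p - pderiv p) * [:0, 0, 1:]) s) (at s)"
      using 2 by (simp add: exp_flat_def)
    ultimately show ?thesis
      using DERIV_cong_ev[OF refl _ refl, of "exp_flat p" "\<lambda>_. 0" s] by blast
  next
    case 3
    \<comment> \<open>Dividing by h multiplies the polynomial by y = 1 / h, which is what
      \<open>pCons 0 p\<close> encodes; the difference quotient is thus again a member of the family
      and tends to 0.\<close>
    have "((\<lambda>h. (exp_flat p (0 + h) - exp_flat p 0) / h) \<longlongrightarrow> 0) (at 0)"
      by (rule Lim_transform_eventually[OF exp_flat_tendsto_0[of "pCons 0 p"]])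
        (auto simp: exp_flat_def eventually_at_filter)
    then show ?thesis using 3 by (simp add: DERIV_def exp_flat_def)
  qed
qed

lemma C_k_exp_flat: "C_k k (exp_flat p)"
proof (induction k arbitrary: p)
  case 0
  have "isCont (exp_flat p) s" for s by (rule DERIV_isCont[OF DERIV_exp_flat])
  then show ?case by (simp add: continuous_on_eq_continuous_at)
next
  case (Suc k)
  show ?case by (rule C_k_SucI_real[OF DERIV_exp_flat Suc])
qed

section \<open>Compactly supported smooth functions and their calculus\<close>

lemma test_functionsI:
  assumes "\<And>k. C_k k \<phi>" "compact K" "K \<subseteq> S" "\<And>x. x \<notin> K \<Longrightarrow> \<phi> x = 0"
  shows "\<phi> \<in> test_functions S"
proof -
  have "closure {x. \<phi> x \<noteq> 0} \<subseteq> K"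
    using assms by (intro closure_minimal) (auto intro: compact_imp_closed)
  moreover from this have "compact (closure {x. \<phi> x \<noteq> 0})"
    using assms(2) bounded_subset[OF compact_imp_bounded] by (blast intro: closed_closure compact_eq_bounded_closed[THEN iffD2])
  ultimately show ?thesis using assms by (auto simp: test_functions_def)
qed

text \<open>Together with \<open>test_functionsI\<close> this replaces the closed support by any
  compact \<open>K\<close> off which \<phi> vanishes, so that supports of sums, multiples and
  derivatives need not be computed.\<close>

lemma test_functionsE:
  assumes "\<phi> \<in> test_functions S"
  obtains K where "compact K" "K \<subseteq> S" "\<And>x. x \<notin> K \<Longrightarrow> \<phi> x = 0"
  using assms closure_subset[of "{x. \<phi> x \<noteq> 0}"]
  by (intro that[of "closure {x. \<phi> x \<noteq> 0}"]) (auto simp: test_functions_def)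

lemma test_functions_C_k: "\<phi> \<in> test_functions S \<Longrightarrow> C_k k \<phi>"
  by (simp add: test_functions_def)

lemma test_functions_add:
  assumes "\<phi> \<in> test_functions S" "\<psi> \<in> test_functions S"
  shows "(\<lambda>x. \<phi> x + \<psi> x) \<in> test_functions S"
proof -
  obtain K L where "compact K" "K \<subseteq> S" "\<And>x. x \<notin> K \<Longrightarrow> \<phi> x = 0"
    and "compact L" "L \<subseteq> S" "\<And>x. x \<notin> L \<Longrightarrow> \<psi> x = 0"
    using assms by (metis test_functionsE)
  then show ?thesis using assms
    by (intro test_functionsI[of _ "K \<union> L"] C_k_add) (auto simp: test_functions_C_k compact_Un)
qed

lemma test_functions_cmult:
  assumes "\<phi> \<in> test_functions S"
  shows "(\<lambda>x. r * \<phi> x) \<in> test_functions S"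
proof -
  obtain K where "compact K" "K \<subseteq> S" "\<And>x. x \<notin> K \<Longrightarrow> \<phi> x = 0"
    using assms by (metis test_functionsE)
  then show ?thesis using assms
    by (intro test_functionsI[of _ K] C_k_mult C_k_const) (auto simp: test_functions_C_k)
qed

lemma test_functions_continuous: "\<phi> \<in> test_functions S \<Longrightarrow> continuous_on UNIV \<phi>"
  using test_functions_C_k[of \<phi> S 0] by simp

lemma test_functions_frechet_derivative:
  assumes "\<phi> \<in> test_functions S" "b \<in> Basis"
  shows "(\<lambda>x. frechet_derivative \<phi> (at x) b) \<in> test_functions S"
proof -
  obtain K where K: "compact K" "K \<subseteq> S" "\<And>x. x \<notin> K \<Longrightarrow> \<phi> x = 0"
    using assms by (metis test_functionsE)
  show ?thesis
  proof (rule test_functionsI[OF _ K(1,2)])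
    show "C_k k (\<lambda>x. frechet_derivative \<phi> (at x) b)" for k
      using C_k_SucD(2)[OF test_functions_C_k[OF assms(1)] assms(2)] .
    fix x assume "x \<notin> K"
    then have "(\<phi> has_derivative (\<lambda>_. 0)) (at x)"
      using K(3) compact_imp_closed[OF K(1)]
      by (intro has_derivative_transform_within_open[OF has_derivative_const[of 0], of "- K"]) auto
    from frechet_derivative_at[OF this] show "frechet_derivative \<phi> (at x) b = 0" by metis
  qed
qed

lemma test_functions_deriv:
  assumes "\<phi> \<in> test_functions S"
  shows "deriv \<phi> \<in> test_functions S" and "(\<phi> has_real_derivative deriv \<phi> t) (at t)"
proof -
  have d: "\<phi> differentiable (at x)" for x
    using test_functions_C_k[OF assms, of "Suc 0"] by simp
  then show "(\<phi> has_real_derivative deriv \<phi> t) (at t)"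
    by (simp add: DERIV_deriv_iff_real_differentiable)
  show "deriv \<phi> \<in> test_functions S"
    using test_functions_frechet_derivative[OF assms, of 1] d by (simp add: frechet_derivative_eq_deriv)
qed

lemma test_functions_bounded:
  assumes "\<phi> \<in> test_functions S"
  obtains B where "\<And>x. \<bar>\<phi> x\<bar> \<le> B"
proof -
  obtain K where K: "compact K" "\<And>x. x \<notin> K \<Longrightarrow> \<phi> x = 0"
    using assms by (metis test_functionsE)
  have "compact (\<phi> ` K)"
    using K(1) continuous_on_subset[OF test_functions_continuous[OF assms]]
    by (intro compact_continuous_image) auto
  then obtain B where "\<And>x. x \<in> K \<Longrightarrow> \<bar>\<phi> x\<bar> \<le> B"
    using compact_imp_bounded[of "\<phi> ` K"] by (auto simp: bounded_iff)
  then have "\<bar>\<phi> x\<bar> \<le> max B 0" for x using K(2)[of x] by (cases "x \<in> K") (auto simp: le_max_iff_disj)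
  then show ?thesis by (rule that)
qed

lemma test_functions_measurable:
  "\<phi> \<in> test_functions S \<Longrightarrow> \<phi> \<in> borel_measurable borel"
  by (intro borel_measurable_continuous_onI test_functions_continuous)

text \<open>A product over the coordinates of smooth steps, one for each face of the box. The bounds
  0 and 1 prepare dominated convergence, and the limit is the indicator of the open box at every
  point.\<close>

lemma test_functions_box_indicator:
  fixes a b :: "'a::euclidean_space"
  assumes "cbox a b \<subseteq> S"
  obtains \<phi> where "\<And>n::nat. \<phi> n \<in> test_functions S"
    and "\<And>n x. 0 \<le> \<phi> n x" "\<And>n x. \<phi> n x \<le> 1" "\<And>x. (\<lambda>n. \<phi> n x) \<longlonglongrightarrow> indicator (box a b) x"
proof -
  \<comment> \<open>For s > 0 this is exp (- 1 / ((n + 1) s)), which tends to 1 as n grows; for s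
    \<le> 0 it is 0.\<close>
  define e where "e n s = exp_flat 1 (real (Suc n) * s)" for n s
  have e: "0 \<le> e n s" "e n s \<le> 1" for n s by (auto simp: e_def exp_flat_def zero_less_mult_iff)
  have e_lim: "(\<lambda>n. e n s) \<longlonglongrightarrow> 1" if "s > 0" for s
  proof -
    have "(\<lambda>n. exp (- (inverse s * inverse (real (Suc n))))) \<longlonglongrightarrow> exp (- (inverse s * 0))"
      by (intro tendsto_intros LIMSEQ_inverse_real_of_nat)
    moreover have "e n s = exp (- (inverse s * inverse (real (Suc n))))" for n
      using that by (simp add: e_def exp_flat_def zero_less_mult_iff divide_inverse mult.commute)
    ultimately show ?thesis by simp
  qed
  define \<phi> where "\<phi> n x = (\<Prod>i\<in>Basis. e n (x \<bullet> i - a \<bullet> i) * e n (b \<bullet> i - x \<bullet> i))" for n x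
  have out: "\<phi> n x = 0" if "x \<notin> box a b" for n x
  proof -
    obtain i where "i \<in> Basis" "\<not> (a \<bullet> i < x \<bullet> i \<and> x \<bullet> i < b \<bullet> i)"
      using \<open>x \<notin> box a b\<close> by (auto simp: mem_box)
    moreover have "e n s = 0" if "s \<le> 0" for s
      using that by (simp add: e_def exp_flat_def zero_less_mult_iff)
    ultimately have "i \<in> Basis" "e n (x \<bullet> i - a \<bullet> i) * e n (b \<bullet> i - x \<bullet> i) = 0"
      by (metis diff_le_0_iff_le linorder_not_less mult_zero_left mult_zero_right)+
    then show ?thesis unfolding \<phi>_def by (intro prod_zero) auto
  qed
  have smooth: "C_k k (\<phi> n)" for k n
  proof -
    have "C_k k (\<lambda>x. e n (x \<bullet> i - a \<bullet> i))" for i :: 'a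
      using C_k_affine[OF C_k_exp_flat[of k 1], of "real (Suc n) *\<^sub>R i" "- (real (Suc n) * (a \<bullet> i))"]
      by (simp add: e_def algebra_simps)
    moreover have "C_k k (\<lambda>x. e n (b \<bullet> i - x \<bullet> i))" for i :: 'a
      using C_k_affine[OF C_k_exp_flat[of k 1], of "- real (Suc n) *\<^sub>R i" "real (Suc n) * (b \<bullet> i)"]
      by (simp add: e_def algebra_simps)
    ultimately show ?thesis unfolding \<phi>_def by (intro C_k_prod C_k_mult) auto
  qed
  show ?thesis
  proof
    show "\<phi> n \<in> test_functions S" for n
      using assms box_subset_cbox[of a b]
      by (intro test_functionsI[of _ "cbox a b"] smooth out) auto
    show "0 \<le> \<phi> n x" for n x unfolding \<phi>_def by (intro prod_nonneg mult_nonneg_nonneg ballI e)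
    show "\<phi> n x \<le> 1" for n x unfolding \<phi>_def
      by (intro prod_le_1 conjI mult_nonneg_nonneg mult_le_one e)
    show "(\<lambda>n. \<phi> n x) \<longlonglongrightarrow> indicator (box a b) x" for x
    proof (cases "x \<in> box a b")
      case True
      have "(\<lambda>n. \<phi> n x) \<longlonglongrightarrow> (\<Prod>i\<in>(Basis :: 'a set). 1 * 1)"
        unfolding \<phi>_def using True by (intro tendsto_prod tendsto_mult e_lim) (auto simp: mem_box)
      then show ?thesis using True by simp
    qed (simp add: out)
  qed
qed

section \<open>The fundamental lemma of the calculus of variations\<close>

lemma
  fixes f :: "'a::euclidean_space \<Rightarrow> 'b::{banach, second_countable_topology}"
  assumes "S' \<in> sets lebesgue" "S \<in> sets lebesgue" "S' \<subseteq> S"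
  shows integrable_lebesgue_on_subset:
      "integrable (lebesgue_on S) f \<Longrightarrow> integrable (lebesgue_on S') f"
    and integral_lebesgue_on_subset:
      "(LINT x|lebesgue_on S'. f x) = (LINT x|lebesgue_on S. indicator S' x *\<^sub>R f x)"
proof -
  have eq: "indicat_real S x * indicator S' x = indicator S' x" for x
    using assms(3) by (auto simp: indicator_def)
  show "integrable (lebesgue_on S') f" if "integrable (lebesgue_on S) f"
  proof -
    have "integrable lebesgue (\<lambda>x. indicator S' x *\<^sub>R indicator S x *\<^sub>R f x)"
      using that assms by (intro integrable_mult_indicator[OF assms(1)]) (simp add: integrable_restrict_space)
    also have "(\<lambda>x. indicator S' x *\<^sub>R indicator S x *\<^sub>R f x) = (\<lambda>x. indicator S' x *\<^sub>R f x)"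
      using assms(3) by (intro ext) (auto simp: indicator_def)
    finally show ?thesis using assms by (simp add: integrable_restrict_space)
  qed
  show "(LINT x|lebesgue_on S'. f x) = (LINT x|lebesgue_on S. indicator S' x *\<^sub>R f x)"
    using assms by (simp add: integral_restrict_space eq)
qed

lemma integrable_indicator_lebesgue_on:
  fixes f :: "'a::euclidean_space \<Rightarrow> 'b::{banach, second_countable_topology}"
  assumes "integrable (lebesgue_on S) f" "S \<in> sets lebesgue" "A \<in> sets lebesgue"
  shows "integrable (lebesgue_on S) (\<lambda>x. indicator A x *\<^sub>R f x)"
proof -
  have "integrable (lebesgue_on S) (\<lambda>x. indicator (A \<inter> S) x *\<^sub>R f x)"
    using assms by (intro integrable_mult_indicator) (auto simp: sets_restrict_space_iff)
  then show ?thesis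
    by (subst Bochner_Integration.integrable_cong[OF refl, of _ _ "\<lambda>x. indicator (A \<inter> S) x *\<^sub>R f x"])
      (auto simp: indicator_def)
qed

lemma AE_lebesgue_onI:
  "AE x in lebesgue. P x \<Longrightarrow> S \<in> sets lebesgue \<Longrightarrow> AE x in lebesgue_on S. P x"
  by (auto simp: AE_restrict_space_iff)

lemma AE_lebesgue_on_neq:
  fixes a :: real
  assumes "S \<in> sets lebesgue"
  shows "AE x in lebesgue_on S. x \<noteq> a"
  using AE_completion[OF AE_lborel_singleton] assms by (rule AE_lebesgue_onI)

text \<open>Completeness of Lebesgue measure: the preimages under \<open>f\<close> and
  \<open>g\<close> differ by a null set. This serves for integrands such as those containing
  \<open>weak_gradient\<close>, whose values are identified only almost everywhere.\<close>

lemma measurable_lebesgue_on_AE: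
  assumes f: "f \<in> lebesgue_on S \<rightarrow>\<^sub>M N" and S: "S \<in> sets lebesgue"
    and ae: "AE x in lebesgue_on S. f x = g x" and g: "g \<in> S \<rightarrow> space N"
  shows "g \<in> lebesgue_on S \<rightarrow>\<^sub>M N"
proof (rule measurableI)
  show "g x \<in> space N" if "x \<in> space (lebesgue_on S)" for x using that g by auto
  fix A assume A: "A \<in> sets N"
  have "f -` A \<inter> S \<in> sets (lebesgue_on S)" using measurable_sets[OF f A] by simp
  then have "f -` A \<inter> S \<in> sets lebesgue" using S by (simp add: sets_restrict_space_iff)
  then have "g -` A \<inter> S \<in> sets lebesgue"
  proof (rule completion.in_sets_AE[rotated])
    have "AE x in lebesgue. x \<in> S \<longrightarrow> f x = g x"
      using ae S by (simp add: AE_restrict_space_iff)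
    then show "AE x in lebesgue. (x \<in> f -` A \<inter> S) = (x \<in> g -` A \<inter> S)"
      by eventually_elim auto
  qed simp
  then show "g -` A \<inter> space (lebesgue_on S) \<in> sets (lebesgue_on S)"
    using S by (simp add: sets_restrict_space_iff)
qed

text \<open>Dynkin's argument: open boxes are stable under intersection and generate the Borel sets,
  and the sets over which \<open>f\<close> integrates to 0 are closed under complements and
  countable disjoint unions. A Banach-valued function with vanishing integral over every measurable
  set is zero almost everywhere.\<close>

lemma integral_box_eq_0_imp_AE_eq_0:
  fixes f :: "'a::euclidean_space \<Rightarrow> 'b::{banach, second_countable_topology}"
  assumes f: "integrable (lebesgue_on (box a b)) f"
    and box: "\<And>c d. (LINT x|lebesgue_on (box a b). indicator (box c d) x *\<^sub>R f x) = 0"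
  shows "AE x in lebesgue_on (box a b). f x = 0"
proof -
  let ?M = "lebesgue_on (box a b)"
  have borel: "(LINT x|?M. indicator A x *\<^sub>R f x) = 0" if "A \<in> sets borel" for A
  proof -
    have bs: "sets borel = sigma_sets UNIV (range (\<lambda>(c, d). box c d :: 'a set))"
      by (subst borel_eq_box) (simp add: sets_measure_of)
    have int: "integrable ?M (\<lambda>x. indicator B x *\<^sub>R f x)" if "B \<in> sets borel" for B
      using that by (intro integrable_indicator_lebesgue_on f) auto
    \<comment> \<open>The total integral is the case of the box \<open>box a b\<close> itself;
      complements are reduced to it.\<close>
    have all: "(LINT x|?M. f x) = 0"
    proof -
      have "(LINT x|?M. f x) = (LINT x|?M. indicator (box a b) x *\<^sub>R f x)"
        by (rule Bochner_Integration.integral_cong) auto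
      then show ?thesis using box by simp
    qed
    have "Int_stable (range (\<lambda>(c, d). box c d :: 'a set))"
      by (auto simp: Int_stable_def box_Int_box)
    moreover have "range (\<lambda>(c, d). box c d :: 'a set) \<subseteq> Pow UNIV" by simp
    moreover have "A \<in> sigma_sets UNIV (range (\<lambda>(c, d). box c d :: 'a set))"
      using that bs by simp
    ultimately show ?thesis
    proof (induction rule: sigma_sets_induct_disjoint)
      case (basic A)
      then show ?case using box by auto
    next
      case (compl A)
      then have A: "A \<in> sets borel" using bs by simp
      have "(LINT x|?M. indicator (UNIV - A) x *\<^sub>R f x) = (LINT x|?M. f x - indicator A x *\<^sub>R f x)"
        by (rule Bochner_Integration.integral_cong) (auto simp: indicator_def)
      also have "\<dots> = 0" using compl(2) all by (simp add: Bochner_Integration.integral_diff[OF f int[OF A]])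
      finally show ?case .
    next
      case (union A)
      then have A: "A i \<in> sets borel" for i using bs by auto
      have UA: "(\<Union>i. A i) \<in> sets borel" using A by blast
      have "(\<lambda>n. LINT x|?M. indicator (\<Union>i<n. A i) x *\<^sub>R f x) \<longlonglongrightarrow>
          (LINT x|?M. indicator (\<Union>i. A i) x *\<^sub>R f x)"
      proof (rule integral_dominated_convergence[where w = "\<lambda>x. norm (f x)"])
        show "AE x in ?M. (\<lambda>n. indicator (\<Union>i<n. A i) x *\<^sub>R f x) \<longlonglongrightarrow> indicator (\<Union>i. A i) x *\<^sub>R f x"
          by (intro AE_I2 tendsto_scaleR LIMSEQ_indicator_UN tendsto_const)
        show "(\<lambda>x. indicator (\<Union>i. A i) x *\<^sub>R f x) \<in> borel_measurable ?M"
          using int[OF UA] by simp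
        show "(\<lambda>x. indicator (\<Union>i<n. A i) x *\<^sub>R f x) \<in> borel_measurable ?M" for n
          using int[of "\<Union>i<n. A i"] A by (simp add: borel_measurable_integrable)
        show "integrable ?M (\<lambda>x. norm (f x))" using f by simp
        show "AE x in ?M. norm (indicator (\<Union>i<n. A i) x *\<^sub>R f x) \<le> norm (f x)" for n
          by (rule AE_I2) (auto simp: indicator_def)
      qed
      moreover have "(LINT x|?M. indicator (\<Union>i<n. A i) x *\<^sub>R f x) = 0" for n
      proof -
        have ind: "(indicator (\<Union>i<n. A i) x :: real) = (\<Sum>i<n. indicator (A i) x)" for x
          using union(1) by (intro indicator_UN_disjoint) (auto simp: disjoint_family_on_def)
        show ?thesis
          unfolding ind scaleR_sum_left using int[OF A] union(3)
          by (subst Bochner_Integration.integral_sum) auto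
      qed
      ultimately show ?case by (simp add: LIMSEQ_const_iff)
    qed (simp_all)
  qed
  interpret finite_measure ?M
    by (rule finite_measure_lebesgue_on) simp
  show ?thesis
  proof (rule density_zero[OF f])
    fix A assume "A \<in> sets ?M"
    then have A: "A \<in> sets lebesgue" by (simp add: sets_restrict_space_iff)
    \<comment> \<open>A Lebesgue set is a Borel set up to a null set, which no integral
      sees.\<close>
    then obtain B N N' where *: "A = B \<union> N" "N \<subseteq> N'" "N' \<in> null_sets lborel" "B \<in> sets lborel"
      by (rule sets_completionE)
    have "AE x in lebesgue. x \<notin> N'"
      using AE_not_in[OF *(3)] by (rule AE_completion)
    then have "AE x in lebesgue. indicator A x *\<^sub>R f x = indicator B x *\<^sub>R f x"
      by eventually_elim (use * in \<open>auto simp: indicator_def\<close>)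
    then have "AE x in ?M. indicator A x *\<^sub>R f x = indicator B x *\<^sub>R f x"
      by (rule AE_lebesgue_onI) simp
    moreover have "(\<lambda>x. indicator C x *\<^sub>R f x) \<in> borel_measurable ?M" if "C \<in> sets lebesgue" for C
      using that by (intro borel_measurable_integrable integrable_indicator_lebesgue_on f) auto
    ultimately have "set_lebesgue_integral ?M A f = (LINT x|?M. indicator B x *\<^sub>R f x)"
      unfolding set_lebesgue_integral_def using A *(4) by (intro integral_cong_AE) auto
    also have "\<dots> = 0" using *(4) borel by simp
    finally show "set_lebesgue_integral ?M A f = 0" .
  qed
qed

text \<open>Smooth approximations of indicators reduce the claim to boxes whose closure lies in
  \<open>S\<close>, and an open set is a countable union of closed boxes. The values lie in a Banach
  space because the lemma is applied both to scalar functions on \<Omega> and to L2-valued functions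
  of time.\<close>

lemma test_functions_orthogonal_imp_AE_eq_0:
  fixes f :: "'a::euclidean_space \<Rightarrow> 'b::{banach, second_countable_topology}"
  assumes S: "open S" and f: "integrable (lebesgue_on S) f"
    and orth: "\<And>\<phi>. \<phi> \<in> test_functions S \<Longrightarrow> (LINT x|lebesgue_on S. \<phi> x *\<^sub>R f x) = 0"
  shows "AE x in lebesgue_on S. f x = 0"
proof -
  have S_meas: "S \<in> sets lebesgue" using S by (simp add: borel_open)
  have box0: "(LINT x|lebesgue_on S. indicator (box c d) x *\<^sub>R f x) = 0" if cd: "cbox c d \<subseteq> S" for c d
  proof -
    obtain \<phi> where \<phi>: "\<And>n::nat. \<phi> n \<in> test_functions S" "\<And>n x. 0 \<le> \<phi> n x" "\<And>n x. \<phi> n x \<le> 1"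
      "\<And>x. (\<lambda>n. \<phi> n x) \<longlonglongrightarrow> indicator (box c d) x"
      by (metis test_functions_box_indicator[OF cd])
    have "(\<lambda>n. LINT x|lebesgue_on S. \<phi> n x *\<^sub>R f x) \<longlonglongrightarrow> (LINT x|lebesgue_on S. indicator (box c d) x *\<^sub>R f x)"
    proof (rule integral_dominated_convergence[where w = "\<lambda>x. norm (f x)"])
      have [measurable]: "f \<in> borel_measurable (lebesgue_on S)" using f by simp
      show "(\<lambda>x. indicator (box c d) x *\<^sub>R f x) \<in> borel_measurable (lebesgue_on S)"
        using S_meas by (intro borel_measurable_integrable integrable_indicator_lebesgue_on f) auto
      have "\<phi> n \<in> borel_measurable (lebesgue_on S)" for n
        using test_functions_measurable[OF \<phi>(1)] by (intro measurable_restrict_space1 measurable_completion) simp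
      then show "(\<lambda>x. \<phi> n x *\<^sub>R f x) \<in> borel_measurable (lebesgue_on S)" for n by simp
      show "integrable (lebesgue_on S) (\<lambda>x. norm (f x))" using f by simp
      show "AE x in lebesgue_on S. (\<lambda>n. \<phi> n x *\<^sub>R f x) \<longlonglongrightarrow> indicator (box c d) x *\<^sub>R f x"
        using \<phi>(4) by (intro AE_I2 tendsto_scaleR tendsto_const)
      show "AE x in lebesgue_on S. norm (\<phi> n x *\<^sub>R f x) \<le> norm (f x)" for n
        using \<phi>(2,3) by (intro AE_I2) (simp add: mult_left_le_one_le)
    qed
    then show ?thesis using orth[OF \<phi>(1)] by (simp add: LIMSEQ_const_iff)
  qed
  have cbox0: "AE x in lebesgue. x \<in> cbox a b \<longrightarrow> f x = 0" if ab: "cbox a b \<subseteq> S" for a b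
  proof -
    have ab': "box a b \<subseteq> S" using ab box_subset_cbox by blast
    have "AE x in lebesgue_on (box a b). f x = 0"
    proof (rule integral_box_eq_0_imp_AE_eq_0)
      show "integrable (lebesgue_on (box a b)) f"
        using ab' S_meas by (intro integrable_lebesgue_on_subset[OF _ S_meas ab' f]) simp
      fix c d
      \<comment> \<open>The corners of the intersection of the two boxes. The closed box they span
        stays inside \<open>cbox a b\<close>, hence inside \<open>S\<close>, although
        \<open>cbox c d\<close> may leave \<open>S\<close>.\<close>
      define c' where "c' = (\<Sum>i\<in>Basis. max (a \<bullet> i) (c \<bullet> i) *\<^sub>R i)"
      define d' where "d' = (\<Sum>i\<in>Basis. min (b \<bullet> i) (d \<bullet> i) *\<^sub>R i)"
      have eq: "box a b \<inter> box c d = box c' d'" by (simp add: box_Int_box c'_def d'_def)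
      have "cbox c' d' \<subseteq> cbox a b" by (rule subset_box_imp(1)) (auto simp: c'_def d'_def)
      then have "(LINT x|lebesgue_on S. indicator (box c' d') x *\<^sub>R f x) = 0" using ab by (intro box0) auto
      moreover have "(indicator (box c' d') x :: real) = indicator (box a b) x * indicator (box c d) x" for x
        by (simp flip: eq add: indicator_inter_arith)
      ultimately show "(LINT x|lebesgue_on (box a b). indicator (box c d) x *\<^sub>R f x) = 0"
        by (subst integral_lebesgue_on_subset[OF _ S_meas ab']) simp_all
    qed
    then have "AE x in lebesgue. x \<in> box a b \<longrightarrow> f x = 0" by (simp add: AE_restrict_space_iff)
    \<comment> \<open>The faces of a box form a null set, so the open box may be replaced by the
      closed one.\<close>
    moreover have "AE x in lebesgue. x \<notin> cbox a b - box a b"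
      using negligible_frontier_interval[of a b] by (intro AE_not_in) (simp add: negligible_iff_null_sets)
    ultimately show ?thesis by eventually_elim auto
  qed
  obtain D where D: "countable D" "D \<subseteq> Pow S" "\<And>X. X \<in> D \<Longrightarrow> \<exists>a b. X = cbox a b" "\<Union>D = S"
    by (rule open_countable_Union_open_cbox[OF S]) blast
  have "AE x in lebesgue. \<forall>X\<in>D. x \<in> X \<longrightarrow> f x = 0"
    using D(1)
  proof (rule AE_ball_countable[THEN iffD2], intro ballI)
    fix X assume "X \<in> D"
    then obtain a b where "X = cbox a b" "X \<subseteq> S" using D(2,3) by blast
    then show "AE x in lebesgue. x \<in> X \<longrightarrow> f x = 0" using cbox0 by simp
  qed
  then have "AE x in lebesgue. x \<in> S \<longrightarrow> f x = 0"
    by eventually_elim (use D(4) in blast)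
  then show ?thesis using S_meas by (simp add: AE_restrict_space_iff)
qed

section \<open>Traces and indefinite Bochner integrals\<close>

lemma AE_interval_nonempty:
  fixes a b :: real
  assumes "AE t in lebesgue_on {0<..<T}. P t" "0 \<le> a" "a < b" "b \<le> T"
  obtains t where "a < t" "t < b" "P t"
proof -
  have "\<not> negligible {a<..<b}" using assms by (intro open_not_negligible) auto
  moreover have "AE t in lebesgue. t \<in> {0<..<T} \<longrightarrow> P t"
    using assms(1) by (simp add: AE_restrict_space_iff)
  then have "{t. \<not> (t \<in> {0<..<T} \<longrightarrow> P t)} \<in> null_sets lebesgue"
    by (simp add: completion.AE_iff_null_sets)
  then have "negligible {t. \<not> (t \<in> {0<..<T} \<longrightarrow> P t)}" by (simp add: negligible_iff_null_sets)
  ultimately have "\<not> {a<..<b} \<subseteq> {t. \<not> (t \<in> {0<..<T} \<longrightarrow> P t)}" using negligible_subset by blast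
  then show ?thesis using that assms by auto
qed

text \<open>A set of full measure is dense in \<open>{0..T}\<close>, endpoints included. Choosing
  \<open>C\<close> as the diagonal makes traces unique, and choosing it as the graph of the weak
  gradient fixes the initial value of the gradient.\<close>

lemma continuous_on_AE_mem_closed:
  fixes u :: "real \<Rightarrow> 'b::topological_space"
  assumes u: "continuous_on {0..T} u" and C: "closed C"
    and ae: "AE t in lebesgue_on {0<..<T}. u t \<in> C" and "0 < T" and s: "s \<in> {0..T}"
  shows "u s \<in> C"
proof -
  have "\<exists>t. t \<in> {0..T} \<and> u t \<in> C \<and> \<bar>t - s\<bar> < inverse (real (Suc n))" for n
  proof -
    \<comment> \<open>Clipping to [0, T] leaves a nondegenerate interval near \<open>s\<close> even
      when \<open>s\<close> is an endpoint.\<close>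
    define a where "a = max 0 (s - inverse (real (Suc n)))"
    define b where "b = min T (s + inverse (real (Suc n)))"
    have *: "inverse (real (Suc n)) > 0" by simp
    then have "s - inverse (real (Suc n)) < T" "0 < s + inverse (real (Suc n))"
      using s by (auto simp del: of_nat_Suc inverse_positive_iff_positive)
    with * have "0 \<le> a" "a < b" "b \<le> T" using \<open>0 < T\<close> s unfolding a_def b_def
      by (auto simp del: of_nat_Suc)
    then obtain t where "a < t" "t < b" "u t \<in> C" by (rule AE_interval_nonempty[OF ae])
    then show ?thesis unfolding a_def b_def by (intro exI[of _ t]) auto
  qed
  then obtain x where x: "\<And>n. x n \<in> {0..T}" "\<And>n. u (x n) \<in> C"
    "\<And>n. \<bar>x n - s\<bar> < inverse (real (Suc n))" by metis
  have "(\<lambda>n. x n - s) \<longlonglongrightarrow> 0"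
    by (rule Lim_null_comparison[OF _ LIMSEQ_inverse_real_of_nat])
      (use x(3) in \<open>auto intro!: always_eventually less_imp_le simp del: of_nat_Suc\<close>)
  then have "x \<longlonglongrightarrow> s" by (simp add: LIM_zero_iff)
  then have "(\<lambda>n. u (x n)) \<longlonglongrightarrow> u s"
    using u s x(1) unfolding continuous_on_sequentially by (auto simp: o_def)
  then show ?thesis using x(2) by (intro Lim_in_closed_set[OF C]) auto
qed

lemma continuous_on_AE_eq:
  fixes u v :: "real \<Rightarrow> 'b::t2_space"
  assumes "continuous_on {0..T} u" "continuous_on {0..T} v"
    and "AE t in lebesgue_on {0<..<T}. u t = v t" and "0 < T" and "s \<in> {0..T}"
  shows "u s = v s"
proof -
  have "(u s, v s) \<in> {p. \<exists>x. p = (x, x)}"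
    using assms closed_diagonal
    by (intro continuous_on_AE_mem_closed[of T "\<lambda>t. (u t, v t)"] continuous_on_Pair) auto
  then show ?thesis by simp
qed

text \<open>Two continuous representatives coincide on all of \<open>{0..T}\<close>, so the definite
  description in \<open>time_trace\<close> is settled by any one of them.\<close>

lemma time_trace_eq:
  fixes u :: "real \<Rightarrow> 'b::t2_space"
  assumes "continuous_on {0..T} w" "AE t in lebesgue_on {0<..<T}. u t = w t" "0 < T" "s \<in> {0..T}"
  shows "time_trace T u s = w s"
  unfolding time_trace_def
proof (rule the_equality)
  show "\<exists>w'. continuous_on {0..T} w' \<and> (AE t in lebesgue_on {0<..<T}. u t = w' t) \<and> w' s = w s"
    using assms by blast
  fix x assume "\<exists>w'. continuous_on {0..T} w' \<and> (AE t in lebesgue_on {0<..<T}. u t = w' t) \<and> w' s = x"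
  then obtain w' where w': "continuous_on {0..T} w'" "AE t in lebesgue_on {0<..<T}. u t = w' t" "w' s = x"
    by blast
  have "AE t in lebesgue_on {0<..<T}. w' t = w t" using w'(2) assms(2) by eventually_elim simp
  then show "x = w s" using continuous_on_AE_eq[OF w'(1) assms(1)] assms w'(3) by blast
qed

section \<open>Bochner integrals as functions of their limits\<close>

lemma integral_lebesgue_on_interval_split:
  fixes f :: "real \<Rightarrow> 'b::{banach, second_countable_topology}"
  assumes f: "integrable (lebesgue_on {0<..<T}) f" and "0 \<le> s" "s \<le> t" "t \<le> T"
  shows "(LINT r|lebesgue_on {0<..<t}. f r) =
    (LINT r|lebesgue_on {0<..<s}. f r) + (LINT r|lebesgue_on {s<..<t}. f r)"
proof -
  let ?M = "lebesgue_on {0<..<T}"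
  have [measurable]: "f \<in> borel_measurable ?M" using f by simp
  have int: "integrable ?M (\<lambda>r. indicator {a<..<b} r *\<^sub>R f r)" for a b
    by (intro integrable_indicator_lebesgue_on f) auto
  have "AE r in ?M. r \<noteq> s" by (rule AE_lebesgue_on_neq) simp
  then have ae: "AE r in ?M. indicator {0<..<t} r *\<^sub>R f r =
      indicator {0<..<s} r *\<^sub>R f r + indicator {s<..<t} r *\<^sub>R f r"
    using AE_space by eventually_elim (use assms in \<open>auto simp: indicator_def\<close>)
  have "(LINT r|lebesgue_on {0<..<t}. f r) = (LINT r|?M. indicator {0<..<t} r *\<^sub>R f r)"
    using assms by (intro integral_lebesgue_on_subset) auto
  also have "\<dots> = (LINT r|?M. indicator {0<..<s} r *\<^sub>R f r + indicator {s<..<t} r *\<^sub>R f r)"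
    using int by (intro integral_cong_AE ae) auto
  also have "\<dots> = (LINT r|?M. indicator {0<..<s} r *\<^sub>R f r) + (LINT r|?M. indicator {s<..<t} r *\<^sub>R f r)"
    using int by (intro Bochner_Integration.integral_add) auto
  also have "(LINT r|?M. indicator {0<..<s} r *\<^sub>R f r) = (LINT r|lebesgue_on {0<..<s}. f r)"
    using assms by (intro integral_lebesgue_on_subset[symmetric]) auto
  also have "(LINT r|?M. indicator {s<..<t} r *\<^sub>R f r) = (LINT r|lebesgue_on {s<..<t}. f r)"
    using assms by (intro integral_lebesgue_on_subset[symmetric]) auto
  finally show ?thesis .
qed

lemma continuous_on_indefinite_integral:
  fixes f :: "real \<Rightarrow> 'b::{banach, second_countable_topology}"
  assumes f: "integrable (lebesgue_on {0<..<T}) f"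
  shows "continuous_on {0..T} (\<lambda>t. LINT r|lebesgue_on {0<..<t}. f r)"
proof (rule continuous_on_sequentiallyI)
  fix u :: "nat \<Rightarrow> real" and t assume u: "\<forall>n. u n \<in> {0..T}" and t: "t \<in> {0..T}" and lim: "u \<longlonglongrightarrow> t"
  let ?M = "lebesgue_on {0<..<T}"
  have [measurable]: "f \<in> borel_measurable ?M" using f by simp
  have eq: "(LINT r|lebesgue_on {0<..<s}. f r) = (LINT r|?M. indicator {0<..<s} r *\<^sub>R f r)"
    if "s \<in> {0..T}" for s using that by (intro integral_lebesgue_on_subset) auto
  have meas: "(\<lambda>r. indicator {0<..<s} r *\<^sub>R f r) \<in> borel_measurable ?M" for s
    by (intro borel_measurable_integrable integrable_indicator_lebesgue_on f) auto
  have "(\<lambda>n. LINT r|?M. indicator {0<..<u n} r *\<^sub>R f r) \<longlonglongrightarrow> (LINT r|?M. indicator {0<..<t} r *\<^sub>R f r)"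
  proof (rule integral_dominated_convergence[where w = "\<lambda>r. norm (f r)"])
    show "integrable ?M (\<lambda>r. norm (f r))" using f by simp
    show "AE r in ?M. norm (indicator {0<..<u n} r *\<^sub>R f r) \<le> norm (f r)" for n
      by (rule AE_I2) (auto simp: indicator_def)
    \<comment> \<open>At \<open>r = t\<close> the indicators may oscillate with \<open>n\<close>;
      everywhere else they are eventually constant.\<close>
    have "AE r in ?M. r \<noteq> t" by (rule AE_lebesgue_on_neq) simp
    then show "AE r in ?M. (\<lambda>n. indicator {0<..<u n} r *\<^sub>R f r) \<longlonglongrightarrow> indicator {0<..<t} r *\<^sub>R f r"
    proof eventually_elim
      fix r assume "r \<noteq> t"
      have "\<forall>\<^sub>F n in sequentially. r < u n \<longleftrightarrow> r < t"
      proof (cases "r < t")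
        case True
        then show ?thesis using order_tendstoD(1)[OF lim, of r] by simp
      next
        case False
        then have "t < r" using \<open>r \<noteq> t\<close> by simp
        then show ?thesis using order_tendstoD(2)[OF lim, of r] False by (auto elim!: eventually_mono)
      qed
      then show "(\<lambda>n. indicator {0<..<u n} r *\<^sub>R f r) \<longlonglongrightarrow> indicator {0<..<t} r *\<^sub>R f r"
        by (intro tendsto_eventually) (auto elim!: eventually_mono simp: indicator_def)
    qed
  qed (use meas in auto)
  then show "(\<lambda>n. LINT r|lebesgue_on {0<..<u n}. f r) \<longlonglongrightarrow> (LINT r|lebesgue_on {0<..<t}. f r)"
    using u t by (simp add: eq)
qed

text \<open>Summing over a fine uniform partition bounds the total increment by
  \<open>e * (N T - N 0)\<close>. Since \<open>N\<close> is fixed before \<open>e\<close>, letting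
  \<open>e\<close> tend to 0 leaves no increment. This takes the place of the argument that a
  function with zero derivative is constant.\<close>

lemma eq_if_locally_small_increments:
  fixes h :: "real \<Rightarrow> 'b::real_normed_vector"
  assumes "0 < T"
    and small: "\<And>e. e > 0 \<Longrightarrow> \<exists>d>0. \<forall>s t. 0 \<le> s \<and> s \<le> t \<and> t \<le> T \<and> t - s < d \<longrightarrow>
      norm (h t - h s) \<le> e * (N t - N s)"
  shows "h T = h 0"
proof -
  have bound: "norm (h T - h 0) \<le> e * (N T - N 0)" if "e > 0" for e
  proof -
    obtain d where d: "d > 0" "\<And>s t. 0 \<le> s \<Longrightarrow> s \<le> t \<Longrightarrow> t \<le> T \<Longrightarrow> t - s < d \<Longrightarrow>
        norm (h t - h s) \<le> e * (N t - N s)"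
      using small[OF \<open>e > 0\<close>] by blast
    \<comment> \<open>Makes the mesh \<open>T / Suc n\<close> smaller than \<open>d\<close>.\<close>
    obtain n where n: "T / d < real (Suc n)" using reals_Archimedean2[of "T / d"]
      by (metis less_trans lessI of_nat_less_iff)
    define x where "x i = real i * T / real (Suc n)" for i
    have step: "x (Suc i) - x i = T / real (Suc n)" for i
      by (simp add: x_def add_divide_distrib distrib_right flip: diff_divide_distrib)
    have "norm (h (x i) - h (x 0)) \<le> e * (N (x i) - N (x 0))" if "i \<le> Suc n" for i
      using that
    proof (induction i)
      case (Suc i)
      have "x (Suc i) \<le> T"
      proof -
        have "real (Suc i) / real (Suc n) \<le> 1" using Suc.prems by simp
        then have "(real (Suc i) / real (Suc n)) * T \<le> 1 * T" using \<open>0 < T\<close> by (intro mult_right_mono) auto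
        then show ?thesis by (simp add: x_def)
      qed
      moreover have "0 \<le> x i" using \<open>0 < T\<close> by (simp add: x_def)
      moreover have "x (Suc i) - x i < d"
        unfolding step using n d(1) by (simp add: field_simps)
      moreover have "x i \<le> x (Suc i)" using step[of i] \<open>0 < T\<close>
        by (smt (verit) divide_pos_pos of_nat_0_less_iff zero_less_Suc)
      ultimately have "norm (h (x (Suc i)) - h (x i)) \<le> e * (N (x (Suc i)) - N (x i))" by (intro d(2))
      moreover have "norm (h (x i) - h (x 0)) \<le> e * (N (x i) - N (x 0))" using Suc by simp
      moreover have "norm (h (x (Suc i)) - h (x 0)) \<le> norm (h (x (Suc i)) - h (x i)) + norm (h (x i) - h (x 0))"
        using norm_triangle_ineq[of "h (x (Suc i)) - h (x i)" "h (x i) - h (x 0)"] by simp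
      ultimately show ?case by (simp add: algebra_simps)
    qed simp
    from this[of "Suc n"] show ?thesis by (simp add: x_def)
  qed
  have small': "norm (h T - h 0) \<le> e" if "e > 0" for e
  proof -
    \<comment> \<open>The summand 1 keeps the quotient defined when
      \<open>N T = N 0\<close>.\<close>
    have "e / (\<bar>N T - N 0\<bar> + 1) > 0" using that by (simp add: add_nonneg_pos)
    then have "norm (h T - h 0) \<le> e / (\<bar>N T - N 0\<bar> + 1) * (N T - N 0)" by (rule bound)
    also have "\<dots> \<le> e / (\<bar>N T - N 0\<bar> + 1) * (\<bar>N T - N 0\<bar> + 1)"
      using that by (intro mult_left_mono) auto
    also have "\<dots> = e" by (simp add: add_nonneg_pos less_imp_neq[THEN not_sym])
    finally show ?thesis .
  qed
  have "norm (h T - h 0) \<le> 0" by (rule field_le_epsilon) (simp add: small')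
  then show ?thesis by simp
qed

text \<open>The continuous representatives of Banach-valued functions of class W^{1,1}. The density
  \<open>f'\<close> enters only through its integrals; this form passes to subintervals, bounded
  linear images and bilinear products.\<close>

definition has_indefinite_integral ::
    "real \<Rightarrow> (real \<Rightarrow> 'b::{banach, second_countable_topology}) \<Rightarrow> (real \<Rightarrow> 'b) \<Rightarrow> bool" where
  "has_indefinite_integral T f' f \<longleftrightarrow> integrable (lebesgue_on {0<..<T}) f' \<and>
     (\<forall>t\<in>{0..T}. f t = f 0 + (LINT r|lebesgue_on {0<..<t}. f' r))"

lemma has_indefinite_integral_integrable:
  "has_indefinite_integral T f' f \<Longrightarrow> integrable (lebesgue_on {0<..<T}) f'"
  by (simp add: has_indefinite_integral_def)

lemma has_indefinite_integral_eq:
  "has_indefinite_integral T f' f \<Longrightarrow> t \<in> {0..T} \<Longrightarrow> f t = f 0 + (LINT r|lebesgue_on {0<..<t}. f' r)"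
  unfolding has_indefinite_integral_def by blast

lemma has_indefinite_integral_continuous:
  assumes "has_indefinite_integral T f' f"
  shows "continuous_on {0..T} f"
proof -
  have "continuous_on {0..T} (\<lambda>t. f 0 + (LINT r|lebesgue_on {0<..<t}. f' r))"
    using assms by (intro continuous_intros continuous_on_indefinite_integral)
      (simp add: has_indefinite_integral_def)
  then show ?thesis
    by (rule continuous_on_eq) (rule has_indefinite_integral_eq[OF assms, symmetric])
qed

lemma continuous_on_interval_measurable:
  "continuous_on {0..T} f \<Longrightarrow> f \<in> borel_measurable (lebesgue_on {0<..<T::real})"
  by (rule continuous_imp_measurable_on_sets_lebesgue)
    (auto elim: continuous_on_subset)

lemma continuous_on_interval_bounded:
  fixes f :: "real \<Rightarrow> 'b::real_normed_vector"
  assumes "continuous_on {0..T} f"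
  obtains B where "0 \<le> B" "\<And>t. t \<in> {0..T} \<Longrightarrow> norm (f t) \<le> B"
proof -
  have "bounded (f ` {0..T})" using assms by (intro compact_imp_bounded compact_continuous_image) auto
  then obtain B where "\<And>t. t \<in> {0..T} \<Longrightarrow> norm (f t) \<le> B" unfolding bounded_iff by blast
  then have "\<And>t. t \<in> {0..T} \<Longrightarrow> norm (f t) \<le> max B 0" by (auto simp: le_max_iff_disj)
  then show ?thesis using that[of "max B 0"] by simp
qed

lemma continuous_on_interval_integrable:
  fixes f :: "real \<Rightarrow> 'b::{banach, second_countable_topology}"
  assumes "continuous_on {0..T} f"
  shows "integrable (lebesgue_on {0<..<T}) f"
proof -
  obtain B where B: "0 \<le> B" "\<And>t. t \<in> {0..T} \<Longrightarrow> norm (f t) \<le> B"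
    using continuous_on_interval_bounded[OF assms] by blast
  interpret finite_measure "lebesgue_on {0<..<T}" by (rule finite_measure_lebesgue_on) simp
  show ?thesis
    by (rule integrable_const_bound[of _ B])
      (use B continuous_on_interval_measurable[OF assms] in auto)
qed


section \<open>Bilinear products and integration by parts\<close>

lemma integrable_bilinear_continuous:
  fixes f :: "real \<Rightarrow> 'a::{banach, second_countable_topology}"
    and g :: "real \<Rightarrow> 'b::{banach, second_countable_topology}"
    and prod :: "'a \<Rightarrow> 'b \<Rightarrow> 'c::{banach, second_countable_topology}"
  assumes "bounded_bilinear prod"
    and f: "integrable (lebesgue_on {0<..<T}) f" and g: "continuous_on {0..T} g"
  shows "integrable (lebesgue_on {0<..<T}) (\<lambda>t. prod (f t) (g t))"
proof -
  interpret bounded_bilinear prod by fact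
  obtain K where K: "0 \<le> K" "\<And>a b. norm (prod a b) \<le> norm a * norm b * K"
    using nonneg_bounded by blast
  obtain B where B: "0 \<le> B" "\<And>t. t \<in> {0..T} \<Longrightarrow> norm (g t) \<le> B"
    using continuous_on_interval_bounded[OF g] by blast
  have [measurable]: "f \<in> borel_measurable (lebesgue_on {0<..<T})" using f by simp
  have [measurable]: "g \<in> borel_measurable (lebesgue_on {0<..<T})"
    by (rule continuous_on_interval_measurable[OF g])
  have cont: "continuous_on UNIV (\<lambda>x. prod (fst x) (snd x))"
    by (intro continuous_on continuous_intros)
  show ?thesis
  proof (rule Bochner_Integration.integrable_bound)
    show "integrable (lebesgue_on {0<..<T}) (\<lambda>t. norm (f t) * (B * K))" using f by simp
    show "(\<lambda>t. prod (f t) (g t)) \<in> borel_measurable (lebesgue_on {0<..<T})"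
      using borel_measurable_continuous_Pair[of f _ g prod] cont by simp
    show "AE t in lebesgue_on {0<..<T}. norm (prod (f t) (g t)) \<le> norm (norm (f t) * (B * K))"
    proof (rule AE_I2)
      fix t assume "t \<in> space (lebesgue_on {0<..<T})"
      then have "norm (f t) * norm (g t) * K \<le> norm (f t) * B * K"
        using B K by (intro mult_right_mono mult_left_mono) auto
      then show "norm (prod (f t) (g t)) \<le> norm (norm (f t) * (B * K))"
        using K(2)[of "f t" "g t"] B(1) K(1) by (simp add: abs_mult mult.assoc)
    qed
  qed
qed

lemma integrable_continuous_bilinear:
  fixes f :: "real \<Rightarrow> 'a::{banach, second_countable_topology}"
    and g :: "real \<Rightarrow> 'b::{banach, second_countable_topology}"
    and prod :: "'a \<Rightarrow> 'b \<Rightarrow> 'c::{banach, second_countable_topology}"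
  assumes "bounded_bilinear prod"
    and "continuous_on {0..T} f" and "integrable (lebesgue_on {0<..<T}) g"
  shows "integrable (lebesgue_on {0<..<T}) (\<lambda>t. prod (f t) (g t))"
  using integrable_bilinear_continuous[OF bounded_bilinear.flip[OF assms(1)] assms(3,2)] .

lemma has_indefinite_integral_diff:
  assumes "has_indefinite_integral T f' f" "0 \<le> s" "s \<le> t" "t \<le> T"
  shows "f t - f s = (LINT r|lebesgue_on {s<..<t}. f' r)"
proof -
  have "f t = f 0 + (LINT r|lebesgue_on {0<..<t}. f' r)" "f s = f 0 + (LINT r|lebesgue_on {0<..<s}. f' r)"
    using assms by (auto intro!: has_indefinite_integral_eq[OF assms(1)])
  then show ?thesis
    using integral_lebesgue_on_interval_split[OF has_indefinite_integral_integrable[OF assms(1)] assms(2-4)]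
    by (simp only: add_diff_cancel_left add_diff_cancel_left')
qed

lemma has_indefinite_integral_subinterval:
  assumes "has_indefinite_integral T f' f" "t \<le> T"
  shows "has_indefinite_integral t f' f"
  unfolding has_indefinite_integral_def
proof
  show "integrable (lebesgue_on {0<..<t}) f'"
    using assms(2) by (intro integrable_lebesgue_on_subset[OF _ _ _ has_indefinite_integral_integrable[OF assms(1)]]) auto
  show "\<forall>s\<in>{0..t}. f s = f 0 + (LINT r|lebesgue_on {0<..<s}. f' r)"
    using assms(2) by (intro ballI has_indefinite_integral_eq[OF assms(1)]) simp
qed

text \<open>Over a short interval the defect of the product rule is the integral of \<open>f'\<close> and \<open>g'\<close> against
  oscillations of \<open>g\<close> and \<open>f\<close>, hence \<open>o(1)\<close> times an additive interval function.\<close>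

lemma integral_by_parts_bilinear:
  fixes f f' :: "real \<Rightarrow> 'a::{banach, second_countable_topology}"
    and g g' :: "real \<Rightarrow> 'b::{banach, second_countable_topology}"
    and prod :: "'a \<Rightarrow> 'b \<Rightarrow> 'c::{banach, second_countable_topology}"
  assumes bil: "bounded_bilinear prod" and "0 < T"
    and f: "has_indefinite_integral T f' f" and g: "has_indefinite_integral T g' g"
  shows "prod (f T) (g T) - prod (f 0) (g 0) =
    (LINT t|lebesgue_on {0<..<T}. prod (f' t) (g t) + prod (f t) (g' t))"
proof -
  interpret bounded_bilinear prod by fact
  obtain K where K: "0 < K" "\<And>a b. norm (prod a b) \<le> norm a * norm b * K"
    using pos_bounded by blast
  have f_int: "integrable (lebesgue_on {0<..<T}) f'" and g_int: "integrable (lebesgue_on {0<..<T}) g'"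
    using f g by (simp_all add: has_indefinite_integral_integrable)
  have f_cont: "continuous_on {0..T} f" and g_cont: "continuous_on {0..T} g"
    using f g by (simp_all add: has_indefinite_integral_continuous)
  define m where "m t = prod (f' t) (g t) + prod (f t) (g' t)" for t
  \<comment> \<open>Once both oscillations are at most \<open>e\<close>, the integrand of the defect
    is bounded by \<open>e * n\<close>; the integral of \<open>n\<close> supplies the interval
    function \<open>N\<close>.\<close>
  define n where "n t = K * (norm (f' t) + norm (g' t))" for t
  have m_int: "integrable (lebesgue_on {0<..<T}) m"
    unfolding m_def by (rule Bochner_Integration.integrable_add[OF
        integrable_bilinear_continuous[OF bil f_int g_cont] integrable_continuous_bilinear[OF bil f_cont g_int]])
  have n_int: "integrable (lebesgue_on {0<..<T}) n" unfolding n_def using f_int g_int by simp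
  define h where "h t = prod (f t) (g t) - (LINT r|lebesgue_on {0<..<t}. m r)" for t
  define N where "N t = (LINT r|lebesgue_on {0<..<t}. n r)" for t
  have "h T = h 0"
  proof (rule eq_if_locally_small_increments[OF \<open>0 < T\<close>])
    fix e :: real assume "e > 0"
    have "\<exists>d>0. \<forall>t\<in>{0..T}. \<forall>s\<in>{0..T}. dist s t < d \<longrightarrow> dist (f s) (f t) < e"
      using compact_uniformly_continuous[OF f_cont compact_Icc] \<open>e > 0\<close>
      unfolding uniformly_continuous_on_def by simp
    then obtain d1 where d1: "d1 > 0" "\<forall>t\<in>{0..T}. \<forall>s\<in>{0..T}. dist s t < d1 \<longrightarrow> dist (f s) (f t) < e"
      by (elim exE conjE)
    have "\<exists>d>0. \<forall>t\<in>{0..T}. \<forall>s\<in>{0..T}. dist s t < d \<longrightarrow> dist (g s) (g t) < e"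
      using compact_uniformly_continuous[OF g_cont compact_Icc] \<open>e > 0\<close>
      unfolding uniformly_continuous_on_def by simp
    then obtain d2 where d2: "d2 > 0" "\<forall>t\<in>{0..T}. \<forall>s\<in>{0..T}. dist s t < d2 \<longrightarrow> dist (g s) (g t) < e"
      by (elim exE conjE)
    have "norm (h t - h s) \<le> e * (N t - N s)"
      if st: "0 \<le> s" "s \<le> t" "t \<le> T" "t - s < min d1 d2" for s t
    proof -
      let ?M = "lebesgue_on {s<..<t}"
      have sub: "integrable ?M k" if "integrable (lebesgue_on {0<..<T}) k"
        for k :: "real \<Rightarrow> 'd::{banach, second_countable_topology}"
        by (rule integrable_lebesgue_on_subset[OF _ _ _ that]) (use st in auto)
      have i1: "integrable ?M (\<lambda>r. prod (f' r) (g t))"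
        by (rule integrable_bounded_linear[OF bounded_linear_left sub[OF f_int]])
      have i2: "integrable ?M (\<lambda>r. prod (f s) (g' r))"
        by (rule integrable_bounded_linear[OF bounded_linear_right sub[OF g_int]])
      \<comment> \<open>Freezing \<open>g\<close> at the right end and \<open>f\<close> at the left
        end makes the increment of the product exactly the sum of two integrals over the
        interval.\<close>
      have "prod (f t) (g t) - prod (f s) (g s) = prod (f t - f s) (g t) + prod (f s) (g t - g s)"
        by (simp add: diff_left diff_right)
      also have "\<dots> = (LINT r|?M. prod (f' r) (g t)) + (LINT r|?M. prod (f s) (g' r))"
        unfolding has_indefinite_integral_diff[OF f st(1-3)] has_indefinite_integral_diff[OF g st(1-3)]
        using sub[OF f_int] sub[OF g_int]
        by (simp add: integral_bounded_linear[OF bounded_linear_left] integral_bounded_linear[OF bounded_linear_right])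
      also have "\<dots> = (LINT r|?M. prod (f' r) (g t) + prod (f s) (g' r))"
        by (rule Bochner_Integration.integral_add[OF i1 i2, symmetric])
      finally have "h t - h s = (LINT r|?M. prod (f' r) (g t) + prod (f s) (g' r)) - (LINT r|?M. m r)"
        using integral_lebesgue_on_interval_split[OF m_int st(1-3)] by (simp add: h_def algebra_simps)
      also have "\<dots> = (LINT r|?M. prod (f' r) (g t) + prod (f s) (g' r) - m r)"
        by (rule Bochner_Integration.integral_diff[OF Bochner_Integration.integrable_add[OF i1 i2] sub[OF m_int], symmetric])
      also have "norm \<dots> \<le> (LINT r|?M. e * n r)"
      proof (rule Bochner_Integration.integral_norm_bound_integral)
        show "integrable ?M (\<lambda>r. prod (f' r) (g t) + prod (f s) (g' r) - m r)"
          by (rule Bochner_Integration.integrable_diff[OF Bochner_Integration.integrable_add[OF i1 i2] sub[OF m_int]])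
        show "integrable ?M (\<lambda>r. e * n r)" using sub[OF n_int] by simp
        fix r assume "r \<in> space ?M"
        then have r: "s < r" "r < t" by auto
        have fe: "norm (f s - f r) \<le> e" and ge: "norm (g t - g r) \<le> e"
          using d1(2)[rule_format, of r s] d2(2)[rule_format, of r t] r st by (auto simp: dist_norm less_imp_le)
        have "prod (f' r) (g t) + prod (f s) (g' r) - m r = prod (f' r) (g t - g r) + prod (f s - f r) (g' r)"
          by (simp add: m_def diff_left diff_right)
        also have "norm \<dots> \<le> norm (f' r) * norm (g t - g r) * K + norm (f s - f r) * norm (g' r) * K"
          by (rule order_trans[OF norm_triangle_ineq add_mono[OF K(2) K(2)]])
        also have "\<dots> \<le> norm (f' r) * e * K + e * norm (g' r) * K"
          using K(1) fe ge by (intro add_mono mult_right_mono mult_left_mono) auto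
        finally show "norm (prod (f' r) (g t) + prod (f s) (g' r) - m r) \<le> e * n r"
          by (simp add: n_def algebra_simps)
      qed
      also have "(LINT r|?M. e * n r) = e * (N t - N s)"
        using integral_lebesgue_on_interval_split[OF n_int st(1-3)] by (simp add: N_def)
      finally show ?thesis .
    qed
    then show "\<exists>d>0. \<forall>s t. 0 \<le> s \<and> s \<le> t \<and> t \<le> T \<and> t - s < d \<longrightarrow> norm (h t - h s) \<le> e * (N t - N s)"
      using d1(1) d2(1) by (intro exI[of _ "min d1 d2"]) auto
  qed
  then show ?thesis by (simp add: h_def m_def algebra_simps integral_empty)
qed

text \<open>Integration by parts on every [0, t]. The product is again an indefinite integral and
  can itself be a factor: the energy estimate multiplies the weight by
  \<open>P t \<bullet> P t\<close>.\<close>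

lemma has_indefinite_integral_bilinear:
  fixes f f' :: "real \<Rightarrow> 'a::{banach, second_countable_topology}"
    and g g' :: "real \<Rightarrow> 'b::{banach, second_countable_topology}"
    and prod :: "'a \<Rightarrow> 'b \<Rightarrow> 'c::{banach, second_countable_topology}"
  assumes bil: "bounded_bilinear prod"
    and f: "has_indefinite_integral T f' f" and g: "has_indefinite_integral T g' g"
  shows "has_indefinite_integral T (\<lambda>t. prod (f' t) (g t) + prod (f t) (g' t)) (\<lambda>t. prod (f t) (g t))"
proof -
  have "prod (f t) (g t) = prod (f 0) (g 0) + (LINT r|lebesgue_on {0<..<t}. prod (f' r) (g r) + prod (f r) (g' r))"
    if "t \<in> {0..T}" for t
  proof (cases "t = 0")
    case False
    then have "0 < t" using that by simp
    then show ?thesis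
      using integral_by_parts_bilinear[OF bil _ has_indefinite_integral_subinterval[OF f, of t]
          has_indefinite_integral_subinterval[OF g, of t]] that by (simp add: algebra_simps)
  qed (simp add: integral_empty)
  moreover have "integrable (lebesgue_on {0<..<T}) (\<lambda>t. prod (f' t) (g t) + prod (f t) (g' t))"
    by (rule Bochner_Integration.integrable_add[OF
        integrable_bilinear_continuous[OF bil has_indefinite_integral_integrable[OF f] has_indefinite_integral_continuous[OF g]]
        integrable_continuous_bilinear[OF bil has_indefinite_integral_continuous[OF f] has_indefinite_integral_integrable[OF g]]])
  ultimately show ?thesis unfolding has_indefinite_integral_def by blast
qed

lemma has_indefinite_integral_DERIV:
  fixes f :: "real \<Rightarrow> real"
  assumes f: "\<And>t. (f has_real_derivative f' t) (at t)" and f': "continuous_on UNIV f'"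
  shows "has_indefinite_integral T f' f"
proof -
  have int: "integrable (lebesgue_on {0<..<t}) f'" for t
    by (rule continuous_on_interval_integrable) (rule continuous_on_subset[OF f'], simp)
  have "f t = f 0 + (LINT r|lebesgue_on {0<..<t}. f' r)" if "t \<in> {0..T}" for t
  proof -
    have "(f' has_integral f t - f 0) {0..t}"
      using that f
      by (intro fundamental_theorem_of_calculus)
        (auto simp flip: has_real_derivative_iff_has_vector_derivative intro: has_field_derivative_at_within)
    then have "integral {0<..<t} f' = f t - f 0"
      by (simp only: integral_open_interval_real[symmetric] integral_unique)
    then show ?thesis using lebesgue_integral_eq_integral[OF int, of t] by simp
  qed
  then show ?thesis using int unfolding has_indefinite_integral_def by blast
qed

text \<open>Bounded linear maps commute with the Bochner integral. The maps of interest are the two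
  projections of the pair (U, \<nabla>U) and multiplication by \<open>c\<close>.\<close>

lemma has_indefinite_integral_bounded_linear:
  fixes f f' :: "real \<Rightarrow> 'a::{banach, second_countable_topology}"
    and L :: "'a \<Rightarrow> 'b::{banach, second_countable_topology}"
  assumes L: "bounded_linear L" and f: "has_indefinite_integral T f' f"
  shows "has_indefinite_integral T (\<lambda>t. L (f' t)) (\<lambda>t. L (f t))"
proof -
  interpret bounded_linear L by fact
  have "L (f t) = L (f 0) + (LINT r|lebesgue_on {0<..<t}. L (f' r))" if "t \<in> {0..T}" for t
  proof -
    have ft: "has_indefinite_integral t f' f" using that by (intro has_indefinite_integral_subinterval[OF f]) simp
    then have "f t = f 0 + (LINT r|lebesgue_on {0<..<t}. f' r)"
      using that by (intro has_indefinite_integral_eq) auto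
    then have "L (f t) = L (f 0) + L (LINT r|lebesgue_on {0<..<t}. f' r)" by (simp only: add)
    then show ?thesis
      using integral_bounded_linear[OF L has_indefinite_integral_integrable[OF ft]] by (simp only:)
  qed
  moreover have "integrable (lebesgue_on {0<..<T}) (\<lambda>t. L (f' t))"
    by (rule integrable_bounded_linear[OF L has_indefinite_integral_integrable[OF f]])
  ultimately show ?thesis unfolding has_indefinite_integral_def by blast
qed

text \<open>Formulated in an abstract Hilbert space so that one estimate covers the scalar field of
  the time derivative and the vector field of the weighted gradient.\<close>

lemma exp_weighted_energy_inequality:
  fixes P q :: "real \<Rightarrow> 'h::{real_inner, banach, second_countable_topology}"
  assumes "0 < T" and P: "has_indefinite_integral T q P"
  shows "1 / (2 * exp 1 * T) * (LINT t|lebesgue_on {0<..<T}. (norm (P t))\<^sup>2)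
    \<le> (LINT t|lebesgue_on {0<..<T}. q t \<bullet> exp (- t / T) *\<^sub>R P t) + (norm (P 0))\<^sup>2 / 2"
proof -
  let ?M = "lebesgue_on {0<..<T}"
  define \<psi> where "\<psi> t = exp (- t / T)" for t
  have P2: "has_indefinite_integral T (\<lambda>t. q t \<bullet> P t + P t \<bullet> q t) (\<lambda>t. P t \<bullet> P t)"
    by (rule has_indefinite_integral_bilinear[OF bounded_bilinear_inner P P])
  have \<psi>: "has_indefinite_integral T (\<lambda>t. - (1 / T) * \<psi> t) \<psi>"
    unfolding \<psi>_def using \<open>0 < T\<close>
    by (intro has_indefinite_integral_DERIV) (auto intro!: derivative_eq_intros continuous_intros)
  have P_cont: "continuous_on {0..T} P" and \<psi>_cont: "continuous_on {0..T} \<psi>"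
    using P \<psi> by (auto intro: has_indefinite_integral_continuous)
  have int1: "integrable ?M (\<lambda>t. \<psi> t * (P t \<bullet> P t))"
    by (intro continuous_on_interval_integrable continuous_intros P_cont \<psi>_cont)
  have int2: "integrable ?M (\<lambda>t. \<psi> t * (q t \<bullet> P t))"
    by (rule integrable_continuous_bilinear[OF bounded_bilinear_mult \<psi>_cont
        integrable_bilinear_continuous[OF bounded_bilinear_inner has_indefinite_integral_integrable[OF P] P_cont]])
  have "\<psi> T * (P T \<bullet> P T) - \<psi> 0 * (P 0 \<bullet> P 0) =
      (LINT t|?M. - (1 / T) * \<psi> t * (P t \<bullet> P t) + \<psi> t * (q t \<bullet> P t + P t \<bullet> q t))"
    by (rule integral_by_parts_bilinear[OF bounded_bilinear_mult \<open>0 < T\<close> \<psi> P2])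
  also have "\<dots> = (LINT t|?M. - (1 / T) * (\<psi> t * (P t \<bullet> P t)) + 2 * (\<psi> t * (q t \<bullet> P t)))"
    by (rule Bochner_Integration.integral_cong) (auto simp: inner_commute algebra_simps)
  also have "\<dots> = - (1 / T) * (LINT t|?M. \<psi> t * (P t \<bullet> P t)) + 2 * (LINT t|?M. \<psi> t * (q t \<bullet> P t))"
    using int1 int2 by (subst Bochner_Integration.integral_add) auto
  finally have id: "(LINT t|?M. \<psi> t * (q t \<bullet> P t)) + (norm (P 0))\<^sup>2 / 2 =
      \<psi> T * (P T \<bullet> P T) / 2 + 1 / (2 * T) * (LINT t|?M. \<psi> t * (P t \<bullet> P t))"
    by (simp add: \<psi>_def power2_norm_eq_inner field_simps)
  have "exp (- 1) * (LINT t|?M. (norm (P t))\<^sup>2) = (LINT t|?M. exp (- 1) * (P t \<bullet> P t))"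
    by (simp add: power2_norm_eq_inner)
  also have "\<dots> \<le> (LINT t|?M. \<psi> t * (P t \<bullet> P t))"
  proof (rule integral_mono[OF _ int1])
    show "integrable ?M (\<lambda>t. exp (- 1) * (P t \<bullet> P t))"
      by (intro continuous_on_interval_integrable continuous_intros P_cont)
    show "exp (- 1) * (P t \<bullet> P t) \<le> \<psi> t * (P t \<bullet> P t)" if "t \<in> space ?M" for t
      using that \<open>0 < T\<close> by (intro mult_right_mono) (auto simp: \<psi>_def field_simps)
  qed
  finally have "1 / (2 * T) * (exp (- 1) * (LINT t|?M. (norm (P t))\<^sup>2)) \<le>
      1 / (2 * T) * (LINT t|?M. \<psi> t * (P t \<bullet> P t))"
    using \<open>0 < T\<close> by (intro mult_left_mono) auto
  \<comment> \<open>The boundary term at the final time has the favourable sign and is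
    dropped.\<close>
  moreover have "0 \<le> \<psi> T * (P T \<bullet> P T) / 2" by (simp add: \<psi>_def)
  ultimately have "1 / (2 * T) * (exp (- 1) * (LINT t|?M. (norm (P t))\<^sup>2)) \<le>
      (LINT t|?M. \<psi> t * (q t \<bullet> P t)) + (norm (P 0))\<^sup>2 / 2"
    unfolding id by linarith
  then show ?thesis by (simp add: \<psi>_def exp_minus field_simps)
qed

section \<open>Weak time derivatives\<close>

lemma test_functions_endpoints:
  fixes T :: real
  assumes "\<phi> \<in> test_functions {0<..<T}"
  shows "\<phi> 0 = 0" "\<phi> T = 0"
proof -
  obtain K where K: "K \<subseteq> {0<..<T}" "\<And>x. x \<notin> K \<Longrightarrow> \<phi> x = 0"
    using assms by (metis test_functionsE)
  have "0 \<notin> K" "T \<notin> K" using subsetD[OF K(1), of 0] subsetD[OF K(1), of T] by auto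
  with K(2) show "\<phi> 0 = 0" "\<phi> T = 0" by simp_all
qed

lemma integrable_test_function_scaleR:
  fixes f :: "real \<Rightarrow> 'a::{banach, second_countable_topology}"
  assumes "\<phi> \<in> test_functions S" "integrable (lebesgue_on {0<..<T}) f"
  shows "integrable (lebesgue_on {0<..<T}) (\<lambda>t. \<phi> t *\<^sub>R f t)"
  by (rule integrable_continuous_bilinear[OF bounded_bilinear_scaleR _ assms(2)])
    (rule continuous_on_subset[OF test_functions_continuous[OF assms(1)]], simp)

text \<open>Integration by parts against \<phi>, whose values at 0 and \<open>T\<close>
  vanish.\<close>

lemma has_weak_time_deriv_indefinite_integral:
  assumes f: "has_indefinite_integral T f' f" and "0 < T"
  shows "has_weak_time_deriv T f f'"
  unfolding has_weak_time_deriv_def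
proof (intro conjI ballI)
  have f_cont: "continuous_on {0..T} f" and f_int: "integrable (lebesgue_on {0<..<T}) f'"
    using f by (auto intro: has_indefinite_integral_continuous has_indefinite_integral_integrable)
  show f_int': "integrable (lebesgue_on {0<..<T}) f" by (rule continuous_on_interval_integrable[OF f_cont])
  show "integrable (lebesgue_on {0<..<T}) f'" by (rule f_int)
  fix \<phi> assume \<phi>: "\<phi> \<in> test_functions {0<..<T}"
  have "has_indefinite_integral T (deriv \<phi>) \<phi>"
    using test_functions_deriv[OF \<phi>] by (blast intro: has_indefinite_integral_DERIV test_functions_continuous)
  from integral_by_parts_bilinear[OF bounded_bilinear_scaleR \<open>0 < T\<close> this f]
  have "0 = (LINT t|lebesgue_on {0<..<T}. deriv \<phi> t *\<^sub>R f t + \<phi> t *\<^sub>R f' t)"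
    using test_functions_endpoints[OF \<phi>] by simp
  also have "\<dots> = (LINT t|lebesgue_on {0<..<T}. deriv \<phi> t *\<^sub>R f t) + (LINT t|lebesgue_on {0<..<T}. \<phi> t *\<^sub>R f' t)"
    by (rule Bochner_Integration.integral_add[OF
          integrable_test_function_scaleR[OF test_functions_deriv(1)[OF \<phi>] f_int'] integrable_test_function_scaleR[OF \<phi> f_int]])
  finally show "(LINT t|lebesgue_on {0<..<T}. deriv \<phi> t *\<^sub>R f t) = - (LINT t|lebesgue_on {0<..<T}. \<phi> t *\<^sub>R f' t)"
    by (simp add: eq_neg_iff_add_eq_0)
qed

text \<open>The antiderivative that vanishes at 0 is constant on either side of an interval
  \<open>{a..b}\<close> around the support of \<psi>. The left constant is its value at 0, and the
  right one is the integral of \<psi>; both are zero, so the support remains compact in the open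
  interval.\<close>

lemma test_function_antiderivative:
  assumes "0 < T" and \<psi>: "\<psi> \<in> test_functions {0<..<T}"
    and zero: "(LINT t|lebesgue_on {0<..<T}. \<psi> t) = 0"
  obtains \<Psi> where "\<Psi> \<in> test_functions {0<..<T}" "deriv \<Psi> = \<psi>"
proof -
  have cont: "continuous_on UNIV \<psi>" by (rule test_functions_continuous[OF \<psi>])
  then have "\<exists>F. \<forall>x::real. -\<infinity> < ereal x \<longrightarrow> ereal x < \<infinity> \<longrightarrow> (F has_vector_derivative \<psi> x) (at x)"
    by (intro einterval_antiderivative) (auto simp: continuous_on_eq_continuous_at)
  then obtain F where F: "\<And>x. (F has_real_derivative \<psi> x) (at x)"
    by (auto simp: has_real_derivative_iff_has_vector_derivative)
  define \<Psi> where "\<Psi> t = F t - F 0" for t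
  have \<Psi>: "(\<Psi> has_real_derivative \<psi> x) (at x)" for x
    unfolding \<Psi>_def using DERIV_diff[OF F DERIV_const[of "F 0"]] by simp
  obtain K where K: "compact K" "K \<subseteq> {0<..<T}" "\<And>x. x \<notin> K \<Longrightarrow> \<psi> x = 0"
    using \<psi> by (metis test_functionsE)
  obtain a b where ab: "0 < a" "b < T" "K \<subseteq> {a..b}"
  proof (cases "K = {}")
    case True
    \<comment> \<open>With empty support any degenerate interval inside (0, T) will do.\<close>
    then show ?thesis using that[of "T/2" "T/2"] \<open>0 < T\<close> by simp
  next
    case False
    then obtain l u where lu: "l \<in> K" "\<forall>y\<in>K. l \<le> y" "u \<in> K" "\<forall>y\<in>K. y \<le> u"
      using compact_attains_inf[OF K(1)] compact_attains_sup[OF K(1)] by blast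
    then have "0 < l" "u < T" using K(2) by auto
    moreover have "K \<subseteq> {l..u}" using lu by (simp add: subset_iff)
    ultimately show ?thesis by (rule that)
  qed
  have const: "\<Psi> y = \<Psi> x" if "x < y" "\<forall>z. x < z \<and> z < y \<longrightarrow> z \<notin> {a..b}" for x y
  proof (rule DERIV_isconst_end[OF that(1)])
    show "continuous_on {x..y} \<Psi>"
      using \<Psi> by (auto intro!: continuous_at_imp_continuous_on DERIV_isCont)
    fix z assume "x < z" "z < y"
    then have "z \<notin> K" using that(2) subsetD[OF ab(3), of z] by blast
    then show "(\<Psi> has_real_derivative 0) (at z)" using K(3) \<Psi>[of z] by simp
  qed
  have "\<Psi> T = 0"
    using has_indefinite_integral_eq[OF has_indefinite_integral_DERIV[OF \<Psi> cont], of T T] zero \<open>0 < T\<close>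
    by (simp add: \<Psi>_def)
  moreover have "\<Psi> 0 = 0" by (simp add: \<Psi>_def)
  ultimately have out: "\<Psi> t = 0" if "t \<notin> {a..b}" for t
  proof (cases "t < a")
    case True
    then show ?thesis using const[of t 0] const[of 0 t] \<open>\<Psi> 0 = 0\<close> ab(1)
      by (cases t "0 :: real" rule: linorder_cases) auto
  next
    case False
    then have "b < t" using that by auto
    then show ?thesis using const[of t T] const[of T t] \<open>\<Psi> T = 0\<close> ab(2)
      by (cases t T rule: linorder_cases) auto
  qed
  show ?thesis
  proof
    have "C_k k \<Psi>" for k
      by (rule C_k_Suc_imp[OF C_k_SucI_real[OF \<Psi> test_functions_C_k[OF \<psi>]]])
    then show "\<Psi> \<in> test_functions {0<..<T}"
      using ab by (intro test_functionsI[of _ "{a..b}"] out) auto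
    show "deriv \<Psi> = \<psi>" using DERIV_imp_deriv[OF \<Psi>] by blast
  qed
qed

text \<open>The du Bois-Reymond lemma: subtracting a multiple of a fixed test function of integral 1 gives
  every test function an antiderivative that is again a test function.\<close>

lemma has_weak_time_deriv_zero_imp_const:
  assumes "0 < T" and z: "has_weak_time_deriv T z (\<lambda>_. 0)"
  obtains a where "AE t in lebesgue_on {0<..<T}. z t = a"
proof -
  let ?M = "lebesgue_on {0<..<T}"
  interpret finite_measure ?M by (rule finite_measure_lebesgue_on) simp
  have z_int: "integrable ?M z" using z by (simp add: has_weak_time_deriv_def)
  have \<phi>_int: "integrable ?M \<phi>" if "\<phi> \<in> test_functions {0<..<T}" for \<phi>
    by (rule continuous_on_interval_integrable)
      (rule continuous_on_subset[OF test_functions_continuous[OF that]], simp)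
  \<comment> \<open>If every test function had integral 0, the fundamental lemma would make the
    constant 1 vanish almost everywhere.\<close>
  have "\<exists>\<eta>\<in>test_functions {0<..<T}. (LINT t|?M. \<eta> t) \<noteq> 0"
  proof (rule ccontr)
    assume "\<not> ?thesis"
    then have "AE t in ?M. (1 :: real) = 0"
      by (intro test_functions_orthogonal_imp_AE_eq_0) auto
    then show False by (rule AE_interval_nonempty[where a = 0 and b = T]) (use \<open>0 < T\<close> in auto)
  qed
  then obtain \<eta>0 where \<eta>0: "\<eta>0 \<in> test_functions {0<..<T}" "(LINT t|?M. \<eta>0 t) \<noteq> 0" by blast
  define \<eta> where "\<eta> t = inverse (LINT t|?M. \<eta>0 t) * \<eta>0 t" for t
  have \<eta>: "\<eta> \<in> test_functions {0<..<T}" unfolding \<eta>_def by (rule test_functions_cmult[OF \<eta>0(1)])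
  have \<eta>1: "(LINT t|?M. \<eta> t) = 1" using \<eta>0(2) by (simp add: \<eta>_def)
  \<comment> \<open>As \<eta> has integral 1, the average of a constant function against \<eta> is
    that constant; this determines the candidate.\<close>
  define a where "a = (LINT t|?M. \<eta> t *\<^sub>R z t)"
  have "AE t in ?M. z t - a = 0"
  proof (rule test_functions_orthogonal_imp_AE_eq_0)
    show "integrable ?M (\<lambda>t. z t - a)" using z_int by simp
    fix \<phi> assume \<phi>: "\<phi> \<in> test_functions {0<..<T}"
    define m where "m = (LINT t|?M. \<phi> t)"
    define \<psi> where "\<psi> t = \<phi> t + (- m) * \<eta> t" for t
    have \<psi>: "\<psi> \<in> test_functions {0<..<T}"
      unfolding \<psi>_def by (intro test_functions_add test_functions_cmult \<phi> \<eta>)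
    have "(LINT t|?M. \<psi> t) = m + (- m) * (LINT t|?M. \<eta> t)"
      unfolding \<psi>_def m_def using \<phi>_int[OF \<phi>] \<phi>_int[OF \<eta>] by simp
    then have "(LINT t|?M. \<psi> t) = 0" using \<eta>1 by simp
    then obtain \<Psi> where \<Psi>: "\<Psi> \<in> test_functions {0<..<T}" "deriv \<Psi> = \<psi>"
      by (rule test_function_antiderivative[OF \<open>0 < T\<close> \<psi>])
    then have "(LINT t|?M. deriv \<Psi> t *\<^sub>R z t) = - (LINT t|?M. \<Psi> t *\<^sub>R 0)"
      using z unfolding has_weak_time_deriv_def by blast
    then have "0 = (LINT t|?M. \<psi> t *\<^sub>R z t)" using \<Psi>(2) by simp
    also have "\<dots> = (LINT t|?M. \<phi> t *\<^sub>R z t + (- m) *\<^sub>R \<eta> t *\<^sub>R z t)"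
      by (simp add: \<psi>_def scaleR_left_diff_distrib)
    also have "\<dots> = (LINT t|?M. \<phi> t *\<^sub>R z t) + (- m) *\<^sub>R a"
      unfolding a_def integral_scaleR_right[symmetric]
      by (intro Bochner_Integration.integral_add integrable_scaleR_right
          integrable_test_function_scaleR[OF \<phi> z_int] integrable_test_function_scaleR[OF \<eta> z_int])
    finally have "(LINT t|?M. \<phi> t *\<^sub>R z t) = m *\<^sub>R a" by simp
    then show "(LINT t|?M. \<phi> t *\<^sub>R (z t - a)) = 0"
      using integrable_test_function_scaleR[OF \<phi> z_int] \<phi>_int[OF \<phi>]
      by (simp add: scaleR_diff_right m_def)
  qed simp
  then show ?thesis by (intro that[of a]) simp
qed

text \<open>The difference of \<open>u\<close> and the integral of \<open>v\<close> has weak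
  derivative 0, hence is almost everywhere constant. The result is the continuous representative on
  which traces and integration by parts act.\<close>

lemma has_weak_time_deriv_imp_indefinite_integral:
  assumes "0 < T" and uv: "has_weak_time_deriv T u v"
  obtains w where "has_indefinite_integral T v w" "AE t in lebesgue_on {0<..<T}. u t = w t"
proof -
  let ?M = "lebesgue_on {0<..<T}"
  have u: "integrable ?M u" and v: "integrable ?M v" using uv by (simp_all add: has_weak_time_deriv_def)
  define w0 where "w0 t = (LINT r|lebesgue_on {0<..<t}. v r)" for t
  have w0: "has_indefinite_integral T v w0"
    using v by (simp add: has_indefinite_integral_def w0_def integral_empty)
  then have w0v: "has_weak_time_deriv T w0 v" using \<open>0 < T\<close> by (rule has_weak_time_deriv_indefinite_integral)
  then have w0_int: "integrable ?M w0" by (simp add: has_weak_time_deriv_def)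
  have "has_weak_time_deriv T (\<lambda>t. u t - w0 t) (\<lambda>_. 0)"
    unfolding has_weak_time_deriv_def
  proof (intro conjI ballI)
    fix \<phi> assume \<phi>: "\<phi> \<in> test_functions {0<..<T}"
    have "(LINT t|?M. deriv \<phi> t *\<^sub>R (u t - w0 t)) = (LINT t|?M. deriv \<phi> t *\<^sub>R u t) - (LINT t|?M. deriv \<phi> t *\<^sub>R w0 t)"
      using integrable_test_function_scaleR[OF test_functions_deriv(1)[OF \<phi>] u]
        integrable_test_function_scaleR[OF test_functions_deriv(1)[OF \<phi>] w0_int]
      by (simp add: scaleR_diff_right)
    then show "(LINT t|?M. deriv \<phi> t *\<^sub>R (u t - w0 t)) = - (LINT t|?M. \<phi> t *\<^sub>R 0)"
      using uv w0v \<phi> by (simp add: has_weak_time_deriv_def)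
  qed (use u w0_int in simp_all)
  then obtain a where a: "AE t in ?M. u t - w0 t = a"
    by (rule has_weak_time_deriv_zero_imp_const[OF \<open>0 < T\<close>])
  show ?thesis
  proof
    have "w0 0 = 0" by (simp add: w0_def integral_empty)
    then show "has_indefinite_integral T v (\<lambda>t. a + w0 t)"
      using v by (simp add: has_indefinite_integral_def w0_def)
    show "AE t in ?M. u t = a + w0 t" using a by eventually_elim (simp add: algebra_simps)
  qed
qed

text \<open>By the fundamental lemma the choice made in \<open>weak_time_deriv\<close> is harmless:
  any weak derivative found by other means agrees with it almost everywhere.\<close>

lemma has_weak_time_deriv_unique:
  assumes uv: "has_weak_time_deriv T u v" and uv': "has_weak_time_deriv T u' v'"
    and ae: "AE t in lebesgue_on {0<..<T}. u t = u' t"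
  shows "AE t in lebesgue_on {0<..<T}. v t = v' t"
proof -
  let ?M = "lebesgue_on {0<..<T}"
  have u: "integrable ?M u" "integrable ?M u'" and v: "integrable ?M v" "integrable ?M v'"
    using uv uv' by (simp_all add: has_weak_time_deriv_def)
  have "AE t in ?M. v t - v' t = 0"
  proof (rule test_functions_orthogonal_imp_AE_eq_0)
    show "integrable ?M (\<lambda>t. v t - v' t)" using v by simp
    fix \<phi> assume \<phi>: "\<phi> \<in> test_functions {0<..<T}"
    have "(LINT t|?M. deriv \<phi> t *\<^sub>R u t) = (LINT t|?M. deriv \<phi> t *\<^sub>R u' t)"
    proof (rule integral_cong_AE)
      show "AE t in ?M. deriv \<phi> t *\<^sub>R u t = deriv \<phi> t *\<^sub>R u' t" using ae by eventually_elim simp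
    qed (intro borel_measurable_integrable integrable_test_function_scaleR[OF test_functions_deriv(1)[OF \<phi>]] u)+
    then have "(LINT t|?M. \<phi> t *\<^sub>R v t) = (LINT t|?M. \<phi> t *\<^sub>R v' t)"
      using uv uv' \<phi> by (simp add: has_weak_time_deriv_def)
    then show "(LINT t|?M. \<phi> t *\<^sub>R (v t - v' t)) = 0"
      using integrable_test_function_scaleR[OF \<phi> v(1)] integrable_test_function_scaleR[OF \<phi> v(2)]
      by (simp add: scaleR_diff_right)
  qed simp
  then show ?thesis by simp
qed

lemma has_weak_time_deriv_weak_time_deriv:
  assumes "has_weak_time_deriv T u v"
  shows "has_weak_time_deriv T u (weak_time_deriv T u)"
  unfolding weak_time_deriv_def by (rule someI[of _ v]) (rule assms)

lemma has_weak_time_deriv_cong_AE: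
  assumes uv: "has_weak_time_deriv T u v" and u': "integrable (lebesgue_on {0<..<T}) u'"
    and ae: "AE t in lebesgue_on {0<..<T}. u t = u' t"
  shows "has_weak_time_deriv T u' v"
  unfolding has_weak_time_deriv_def
proof (intro conjI ballI)
  let ?M = "lebesgue_on {0<..<T}"
  have u: "integrable ?M u" using uv by (simp add: has_weak_time_deriv_def)
  show "integrable ?M u'" by (rule u')
  show "integrable ?M v" using uv by (simp add: has_weak_time_deriv_def)
  fix \<phi> assume \<phi>: "\<phi> \<in> test_functions {0<..<T}"
  have "(LINT t|?M. deriv \<phi> t *\<^sub>R u t) = (LINT t|?M. deriv \<phi> t *\<^sub>R u' t)"
  proof (rule integral_cong_AE)
    show "AE t in ?M. deriv \<phi> t *\<^sub>R u t = deriv \<phi> t *\<^sub>R u' t" using ae by eventually_elim simp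
  qed (intro borel_measurable_integrable integrable_test_function_scaleR[OF test_functions_deriv(1)[OF \<phi>]] u u')+
  then show "(LINT t|?M. deriv \<phi> t *\<^sub>R u' t) = - (LINT t|?M. \<phi> t *\<^sub>R v t)"
    using uv \<phi> by (simp add: has_weak_time_deriv_def)
qed

section \<open>Multiplication operators and weak gradients\<close>

lemma Linfty_on_bound:
  assumes "c \<in> Linfty_on \<Omega>" "\<Omega> \<in> sets lebesgue"
  obtains M where "(\<lambda>x. indicator \<Omega> x * c x) \<in> borel_measurable lebesgue"
    and "AE x in lebesgue. \<bar>indicator \<Omega> x * c x\<bar> \<le> M"
proof -
  obtain M where c: "c \<in> borel_measurable (lebesgue_on \<Omega>)" "AE x in lebesgue_on \<Omega>. \<bar>c x\<bar> \<le> M"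
    using assms(1) by (auto simp: Linfty_on_def)
  have "(\<lambda>x. indicator \<Omega> x * c x) \<in> borel_measurable lebesgue"
    using c(1) assms(2) by (simp add: borel_measurable_restrict_space_iff)
  moreover have "AE x in lebesgue. x \<in> \<Omega> \<longrightarrow> \<bar>c x\<bar> \<le> M"
    using c(2) assms(2) by (simp add: AE_restrict_space_iff)
  \<comment> \<open>The bound must also cover the value 0 outside \<Omega>, and \<open>M\<close> may
    be negative when \<Omega> is null.\<close>
  then have "AE x in lebesgue. \<bar>indicator \<Omega> x * c x\<bar> \<le> max M 0"
    by eventually_elim (auto simp: indicator_def)
  ultimately show ?thesis by (rule that)
qed

lemma Linfty_on_power2:
  assumes "c \<in> Linfty_on \<Omega>"
  shows "(\<lambda>x. (c x)\<^sup>2) \<in> Linfty_on \<Omega>"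
proof -
  obtain M where c: "c \<in> borel_measurable (lebesgue_on \<Omega>)" "AE x in lebesgue_on \<Omega>. \<bar>c x\<bar> \<le> M"
    using assms by (auto simp: Linfty_on_def)
  have "AE x in lebesgue_on \<Omega>. \<bar>(c x)\<^sup>2\<bar> \<le> M\<^sup>2"
    using c(2) by eventually_elim (metis abs_power2 power2_abs power_mono abs_ge_zero)
  then show ?thesis using c(1) by (auto simp: Linfty_on_def)
qed

lemma Linfty_on_const: "(\<lambda>_. r) \<in> Linfty_on \<Omega>"
  by (auto simp: Linfty_on_def)

lemma square_integrable_bounded_mult:
  fixes f :: "'a::euclidean_space \<Rightarrow> 'b::euclidean_space"
  assumes f: "square_integrable f" and m: "m \<in> borel_measurable lebesgue"
    and M: "AE x in lebesgue. \<bar>m x\<bar> \<le> M"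
  shows "square_integrable (\<lambda>x. m x *\<^sub>R f x)"
    and "norm (abs_L2 (\<lambda>x. m x *\<^sub>R f x)) \<le> \<bar>M\<bar> * norm (abs_L2 f)"
proof -
  have [measurable]: "f \<in> borel_measurable lebesgue" using f by (simp add: square_integrable_def)
  note m [measurable]
  have f2: "integrable lebesgue (\<lambda>x. M\<^sup>2 * (norm (f x))\<^sup>2)" using f by (simp add: square_integrable_def)
  have le: "AE x in lebesgue. (norm (m x *\<^sub>R f x))\<^sup>2 \<le> M\<^sup>2 * (norm (f x))\<^sup>2"
    using M
  proof eventually_elim
    fix x assume "\<bar>m x\<bar> \<le> M"
    then have "\<bar>m x\<bar>\<^sup>2 \<le> M\<^sup>2" by (intro power_mono) auto
    then show "(norm (m x *\<^sub>R f x))\<^sup>2 \<le> M\<^sup>2 * (norm (f x))\<^sup>2"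
      by (simp add: power_mult_distrib mult_right_mono)
  qed
  have int: "integrable lebesgue (\<lambda>x. (norm (m x *\<^sub>R f x))\<^sup>2)"
    by (rule Bochner_Integration.integrable_bound[OF f2]) (use le in auto)
  then show sq: "square_integrable (\<lambda>x. m x *\<^sub>R f x)"
    unfolding square_integrable_def by (intro conjI) measurable
  have "(norm (abs_L2 (\<lambda>x. m x *\<^sub>R f x)))\<^sup>2 \<le> (\<integral>x. M\<^sup>2 * (norm (f x))\<^sup>2 \<partial>lebesgue)"
    unfolding norm_abs_L2_sq[OF sq] by (rule integral_mono_AE[OF int f2 le])
  also have "\<dots> = (\<bar>M\<bar> * norm (abs_L2 f))\<^sup>2"
    by (simp add: norm_abs_L2_sq[OF f] power_mult_distrib)
  finally show "norm (abs_L2 (\<lambda>x. m x *\<^sub>R f x)) \<le> \<bar>M\<bar> * norm (abs_L2 f)"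
    by (rule power2_le_imp_le) simp
qed

lemma mult_L2_eq: "mult_L2 \<Omega> c u = abs_L2 (\<lambda>x. (indicator \<Omega> x * c x) *\<^sub>R rep_L2 u x)"
  by (simp add: mult_L2_def to_L2_def)

lemma square_integrable_mult_L2:
  assumes "c \<in> Linfty_on \<Omega>" "\<Omega> \<in> sets lebesgue"
  shows "square_integrable (\<lambda>x. (indicator \<Omega> x * c x) *\<^sub>R rep_L2 u x)"
  using Linfty_on_bound[OF assms] square_integrable_bounded_mult(1)[OF rep_L2] by metis

lemma rep_L2_add: "AE x in lebesgue. rep_L2 (u + v) x = rep_L2 u x + rep_L2 v x"
  using rep_abs_L2[OF square_integrable_add[OF rep_L2 rep_L2], of u v]
  by (simp add: abs_L2_add[OF rep_L2 rep_L2, symmetric] abs_rep_L2)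

lemma rep_L2_scaleR: "AE x in lebesgue. rep_L2 (r *\<^sub>R u) x = r *\<^sub>R rep_L2 u x"
  using rep_abs_L2[OF square_integrable_scaleR[OF rep_L2], of r u]
  by (simp add: abs_L2_scaleR[OF rep_L2 rep_L2, symmetric] abs_rep_L2)

lemma bounded_linear_mult_L2:
  fixes \<Omega> :: "'a::euclidean_space set"
  assumes c: "c \<in> Linfty_on \<Omega>" and \<Omega>: "\<Omega> \<in> sets lebesgue"
  shows "bounded_linear (mult_L2 \<Omega> c :: ('a, 'b::euclidean_space) L2 \<Rightarrow> _)"
proof -
  note sq = square_integrable_mult_L2[OF c \<Omega>]
  obtain M where M: "(\<lambda>x. indicator \<Omega> x * c x) \<in> borel_measurable lebesgue"
      "AE x in lebesgue. \<bar>indicator \<Omega> x * c x\<bar> \<le> M"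
    using Linfty_on_bound[OF c \<Omega>] by blast
  show ?thesis
  proof (rule bounded_linear_intro[where K = "\<bar>M\<bar>"])
    fix u v :: "('a, 'b) L2" and r :: real
    show "mult_L2 \<Omega> c (u + v) = mult_L2 \<Omega> c u + mult_L2 \<Omega> c v"
      unfolding mult_L2_eq abs_L2_add[OF sq sq] abs_L2_eq_iff[OF sq square_integrable_add[OF sq sq]]
      using rep_L2_add[of u v] by eventually_elim (simp add: scaleR_add_right)
    show "mult_L2 \<Omega> c (r *\<^sub>R u) = r *\<^sub>R mult_L2 \<Omega> c u"
      unfolding mult_L2_eq abs_L2_scaleR[OF sq sq] abs_L2_eq_iff[OF sq square_integrable_scaleR[OF sq]]
      using rep_L2_scaleR[of r u] by eventually_elim simp
    show "norm (mult_L2 \<Omega> c u) \<le> norm u * \<bar>M\<bar>"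
      using square_integrable_bounded_mult(2)[OF rep_L2 M, of u]
      by (simp add: mult_L2_eq abs_rep_L2 mult.commute)
  qed
qed

text \<open>Gives one factor \<open>c\<close> to each argument, so that the spatial term of the form
  becomes an inner product of two weighted gradients.\<close>

lemma inner_mult_L2_power2:
  assumes c: "c \<in> Linfty_on \<Omega>" and \<Omega>: "\<Omega> \<in> sets lebesgue"
  shows "mult_L2 \<Omega> (\<lambda>x. (c x)\<^sup>2) u \<bullet> v = mult_L2 \<Omega> c u \<bullet> mult_L2 \<Omega> c v"
proof -
  have "mult_L2 \<Omega> (\<lambda>x. (c x)\<^sup>2) u \<bullet> abs_L2 (rep_L2 v) = mult_L2 \<Omega> c u \<bullet> mult_L2 \<Omega> c v"
    unfolding mult_L2_eq
      abs_L2_inner[OF square_integrable_mult_L2[OF Linfty_on_power2[OF c] \<Omega>] rep_L2]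
      abs_L2_inner[OF square_integrable_mult_L2[OF c \<Omega>] square_integrable_mult_L2[OF c \<Omega>]]
    by (rule Bochner_Integration.integral_cong) (auto simp: indicator_def power2_eq_square)
  then show ?thesis by (simp add: abs_rep_L2)
qed

text \<open>As the fixed points of a bounded linear map, the functions vanishing outside \<Omega>
  form a closed subspace.\<close>

lemma L2_on_eq:
  assumes "\<Omega> \<in> sets lebesgue"
  shows "L2_on \<Omega> = {u. mult_L2 \<Omega> (\<lambda>_. 1) u = u}"
proof -
  have "mult_L2 \<Omega> (\<lambda>_. 1) u = u \<longleftrightarrow> (AE x in lebesgue. x \<notin> \<Omega> \<longrightarrow> rep_L2 u x = 0)" for u :: "('a, 'b) L2"
  proof -
    have "mult_L2 \<Omega> (\<lambda>_. 1) u = abs_L2 (rep_L2 u) \<longleftrightarrow>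
        (AE x in lebesgue. (indicator \<Omega> x * 1) *\<^sub>R rep_L2 u x = rep_L2 u x)"
      unfolding mult_L2_eq
      by (rule abs_L2_eq_iff[OF square_integrable_mult_L2[OF Linfty_on_const assms] rep_L2])
    also have "\<dots> \<longleftrightarrow> (AE x in lebesgue. x \<notin> \<Omega> \<longrightarrow> rep_L2 u x = 0)"
      by (intro AE_cong) (auto simp: indicator_def)
    finally show ?thesis by (simp add: abs_rep_L2)
  qed
  then show ?thesis by (simp add: L2_on_def)
qed

lemma
  assumes "\<Omega> \<in> sets lebesgue"
  shows closed_L2_on: "closed (L2_on \<Omega>)" and subspace_L2_on: "subspace (L2_on \<Omega>)"
proof -
  interpret bounded_linear "mult_L2 \<Omega> (\<lambda>_. 1)"
    by (rule bounded_linear_mult_L2[OF Linfty_on_const assms])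
  show "closed (L2_on \<Omega>)"
    unfolding L2_on_eq[OF assms] by (intro closed_Collect_eq continuous_on continuous_on_id)
  show "subspace (L2_on \<Omega>)"
    unfolding L2_on_eq[OF assms] by (rule subspaceI) (simp_all add: zero add scaleR)
qed

text \<open>A test function is a bounded multiple of the indicator of a compact set, hence
  square-integrable. The vector \<open>b\<close> lets one statement cover the vector fields \<phi> b
  and, with \<open>b = 1\<close>, the scalar partial derivatives.\<close>

lemma square_integrable_test_function:
  fixes \<phi> :: "'a::euclidean_space \<Rightarrow> real" and b :: "'b::euclidean_space"
  assumes \<phi>: "\<phi> \<in> test_functions S" and \<Omega>: "\<Omega> \<in> sets lebesgue"
  shows "square_integrable (\<lambda>x. indicator \<Omega> x *\<^sub>R \<phi> x *\<^sub>R b)"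
proof -
  obtain K where K: "compact K" "\<And>x. x \<notin> K \<Longrightarrow> \<phi> x = 0" using \<phi> by (metis test_functionsE)
  obtain B where B: "\<And>x. \<bar>\<phi> x\<bar> \<le> B" using \<phi> by (metis test_functions_bounded)
  have [measurable]: "\<phi> \<in> borel_measurable lebesgue"
    using test_functions_measurable[OF \<phi>] by (simp add: measurable_completion)
  have "square_integrable (\<lambda>x. (indicator \<Omega> x * \<phi> x) *\<^sub>R indicator K x *\<^sub>R b)"
  proof (rule square_integrable_bounded_mult(1))
    show "square_integrable (\<lambda>x. indicator K x *\<^sub>R b)"
      by (rule square_integrable_indicator) (rule lmeasurable_compact[OF K(1)])
    show "(\<lambda>x. indicator \<Omega> x * \<phi> x) \<in> borel_measurable lebesgue" using \<Omega> by simp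
    show "AE x in lebesgue. \<bar>indicator \<Omega> x * \<phi> x\<bar> \<le> B"
      using B by (intro AE_I2) (auto simp: indicator_def intro: order_trans[OF abs_ge_zero])
  qed
  also have "(\<lambda>x. (indicator \<Omega> x * \<phi> x) *\<^sub>R indicator K x *\<^sub>R b) = (\<lambda>x. indicator \<Omega> x *\<^sub>R \<phi> x *\<^sub>R b)"
    using K(2) by (intro ext) (auto simp: indicator_def)
  finally show ?thesis .
qed

section \<open>The weak gradient as a closed, single-valued linear relation\<close>

lemma inner_to_L2:
  assumes "square_integrable (\<lambda>x. indicator \<Omega> x *\<^sub>R h x)" "\<Omega> \<in> sets lebesgue"
  shows "to_L2 \<Omega> h \<bullet> u = (LINT x|lebesgue_on \<Omega>. h x \<bullet> rep_L2 u x)"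
proof -
  have "to_L2 \<Omega> h \<bullet> abs_L2 (rep_L2 u) = (\<integral>x. (indicator \<Omega> x *\<^sub>R h x) \<bullet> rep_L2 u x \<partial>lebesgue)"
    unfolding to_L2_def by (rule abs_L2_inner[OF assms(1) rep_L2])
  then show ?thesis using assms(2) by (simp add: abs_rep_L2 integral_restrict_space)
qed

text \<open>Rewrites the defining integrals as inner products with fixed elements, that is, as
  continuous linear conditions on the pair \<open>(u, g)\<close>; scaling and closedness of the
  graph can be read off from them.\<close>

lemma has_weak_gradient_iff:
  assumes \<Omega>: "\<Omega> \<in> sets lebesgue"
  shows "has_weak_gradient \<Omega> u g \<longleftrightarrow> u \<in> L2_on \<Omega> \<and> g \<in> L2_on \<Omega> \<and>
    (\<forall>\<phi>\<in>test_functions \<Omega>. \<forall>b\<in>Basis.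
      to_L2 \<Omega> (\<lambda>x. frechet_derivative \<phi> (at x) b *\<^sub>R 1) \<bullet> u = - (to_L2 \<Omega> (\<lambda>x. \<phi> x *\<^sub>R b) \<bullet> g))"
proof -
  have "(LINT x|lebesgue_on \<Omega>. rep_L2 u x * frechet_derivative \<phi> (at x) b) =
      to_L2 \<Omega> (\<lambda>x. frechet_derivative \<phi> (at x) b *\<^sub>R 1) \<bullet> u"
    if "\<phi> \<in> test_functions \<Omega>" "b \<in> Basis" for \<phi> b
    using inner_to_L2[OF square_integrable_test_function[OF test_functions_frechet_derivative[OF that] \<Omega>] \<Omega>, of 1 u]
    by (simp add: mult.commute)
  moreover have "(LINT x|lebesgue_on \<Omega>. (rep_L2 g x \<bullet> b) * \<phi> x) = to_L2 \<Omega> (\<lambda>x. \<phi> x *\<^sub>R b) \<bullet> g"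
    if "\<phi> \<in> test_functions \<Omega>" "b \<in> Basis" for \<phi> b
    using inner_to_L2[OF square_integrable_test_function[OF that(1) \<Omega>] \<Omega>, of b g]
    by (simp add: mult.commute inner_commute)
  ultimately show ?thesis by (simp add: has_weak_gradient_def)
qed

lemma has_weak_gradient_scaleR:
  assumes "\<Omega> \<in> sets lebesgue" "has_weak_gradient \<Omega> u g"
  shows "has_weak_gradient \<Omega> (r *\<^sub>R u) (r *\<^sub>R g)"
  using assms(2) unfolding has_weak_gradient_iff[OF assms(1)]
  by (auto intro: subspace_scale[OF subspace_L2_on[OF assms(1)]])

lemma has_weak_gradient_0: "\<Omega> \<in> sets lebesgue \<Longrightarrow> has_weak_gradient \<Omega> 0 0"
  by (simp add: has_weak_gradient_iff subspace_0 subspace_L2_on)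

lemma closed_H1_graph:
  assumes \<Omega>: "\<Omega> \<in> sets lebesgue"
  shows "closed (H1_graph \<Omega>)"
  unfolding closed_sequential_limits
proof (intro allI impI, elim conjE)
  fix x l assume x: "\<forall>n. x n \<in> H1_graph \<Omega>" and lim: "x \<longlonglongrightarrow> l"
  have lim1: "(\<lambda>n. fst (x n)) \<longlonglongrightarrow> fst l" and lim2: "(\<lambda>n. snd (x n)) \<longlonglongrightarrow> snd l"
    using lim by (auto intro: tendsto_fst tendsto_snd)
  have xn: "has_weak_gradient \<Omega> (fst (x n)) (snd (x n))" for n
    using x by (auto simp: H1_graph_def split: prod.splits)
  have "has_weak_gradient \<Omega> (fst l) (snd l)"
    unfolding has_weak_gradient_iff[OF \<Omega>]
  proof (intro conjI ballI)
    show "fst l \<in> L2_on \<Omega>" "snd l \<in> L2_on \<Omega>"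
      using xn unfolding has_weak_gradient_def
      by (blast intro: closed_sequentially[OF closed_L2_on[OF \<Omega>] _ lim1]
          closed_sequentially[OF closed_L2_on[OF \<Omega>] _ lim2])+
    fix \<phi> and b :: 'a assume "\<phi> \<in> test_functions \<Omega>" "b \<in> Basis"
    then have "to_L2 \<Omega> (\<lambda>y. frechet_derivative \<phi> (at y) b *\<^sub>R 1) \<bullet> fst (x n) =
        - (to_L2 \<Omega> (\<lambda>y. \<phi> y *\<^sub>R b) \<bullet> snd (x n))" for n
      using xn[of n] unfolding has_weak_gradient_iff[OF \<Omega>] by blast
    moreover have "(\<lambda>n. to_L2 \<Omega> (\<lambda>y. frechet_derivative \<phi> (at y) b *\<^sub>R 1) \<bullet> fst (x n)) \<longlonglongrightarrow>
        to_L2 \<Omega> (\<lambda>y. frechet_derivative \<phi> (at y) b *\<^sub>R 1) \<bullet> fst l"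
      by (intro tendsto_intros lim1)
    moreover have "(\<lambda>n. - (to_L2 \<Omega> (\<lambda>y. \<phi> y *\<^sub>R b) \<bullet> snd (x n))) \<longlonglongrightarrow> - (to_L2 \<Omega> (\<lambda>y. \<phi> y *\<^sub>R b) \<bullet> snd l)"
      by (intro tendsto_intros lim2)
    ultimately show "to_L2 \<Omega> (\<lambda>y. frechet_derivative \<phi> (at y) b *\<^sub>R 1) \<bullet> fst l =
        - (to_L2 \<Omega> (\<lambda>y. \<phi> y *\<^sub>R b) \<bullet> snd l)"
      using LIMSEQ_unique by simp
  qed
  then show "l \<in> H1_graph \<Omega>" by (simp add: H1_graph_def case_prod_unfold)
qed

text \<open>The difference of two gradients is orthogonal to all fields \<phi> b, so the fundamental
  lemma applies to each component inside \<Omega>; outside \<Omega> both gradients vanish.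
  Boundedness of \<Omega> provides the integrability that this lemma asks for.\<close>

lemma has_weak_gradient_unique:
  fixes \<Omega> :: "'a::euclidean_space set"
  assumes "open \<Omega>" "bounded \<Omega>" and g: "has_weak_gradient \<Omega> u g" and g': "has_weak_gradient \<Omega> u g'"
  shows "g = g'"
proof -
  have \<Omega>: "\<Omega> \<in> sets lebesgue" using \<open>open \<Omega>\<close> by (simp add: borel_open)
  interpret finite_measure "lebesgue_on \<Omega>"
    by (rule finite_measure_lebesgue_on) (rule lmeasurable_open[OF assms(2,1)])
  define d where "d = g - g'"
  have d: "d \<in> L2_on \<Omega>"
    using g g' unfolding d_def has_weak_gradient_def
    by (blast intro: subspace_diff[OF subspace_L2_on[OF \<Omega>]])
  have sq: "square_integrable (rep_L2 d)" by (rule rep_L2)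
  have [measurable]: "rep_L2 d \<in> borel_measurable (lebesgue_on \<Omega>)"
    using sq by (auto simp: square_integrable_def intro: measurable_restrict_space1)
  have int2: "integrable (lebesgue_on \<Omega>) (\<lambda>x. (norm (rep_L2 d x))\<^sup>2)"
    using integrable_lebesgue_on_subset[of \<Omega> UNIV "\<lambda>x. (norm (rep_L2 d x))\<^sup>2"] \<Omega> sq
    by (simp add: lebesgue_on_UNIV_eq square_integrable_def)
  have int: "integrable (lebesgue_on \<Omega>) (rep_L2 d)"
  proof (rule Bochner_Integration.integrable_bound)
    \<comment> \<open>On a set of finite measure, square-integrable functions are
      integrable.\<close>
    show "integrable (lebesgue_on \<Omega>) (\<lambda>x. 1 + (norm (rep_L2 d x))\<^sup>2)" using int2 by simp
    have "norm y \<le> 1 + (norm y)\<^sup>2" for y :: 'a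
      using zero_le_power2[of "norm y - 1"] norm_ge_zero[of y] unfolding power2_diff
      by (simp only: one_power2 mult_1_right)
    then show "AE x in lebesgue_on \<Omega>. norm (rep_L2 d x) \<le> norm (1 + (norm (rep_L2 d x))\<^sup>2)"
      by (intro AE_I2) (simp add: abs_of_nonneg)
  qed simp
  have "AE x in lebesgue_on \<Omega>. rep_L2 d x \<bullet> b = 0" if b: "b \<in> Basis" for b
  proof (rule test_functions_orthogonal_imp_AE_eq_0[OF \<open>open \<Omega>\<close>])
    show "integrable (lebesgue_on \<Omega>) (\<lambda>x. rep_L2 d x \<bullet> b)" using int by simp
    fix \<phi> assume \<phi>: "\<phi> \<in> test_functions \<Omega>"
    have "to_L2 \<Omega> (\<lambda>x. \<phi> x *\<^sub>R b) \<bullet> g = to_L2 \<Omega> (\<lambda>x. \<phi> x *\<^sub>R b) \<bullet> g'"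
      using g g' \<phi> b unfolding has_weak_gradient_iff[OF \<Omega>] by (metis neg_equal_iff_equal)
    then have "to_L2 \<Omega> (\<lambda>x. \<phi> x *\<^sub>R b) \<bullet> d = 0" by (simp add: d_def inner_diff_right)
    then show "(LINT x|lebesgue_on \<Omega>. \<phi> x *\<^sub>R (rep_L2 d x \<bullet> b)) = 0"
      using inner_to_L2[OF square_integrable_test_function[OF \<phi> \<Omega>] \<Omega>, of b d]
      by (simp add: inner_commute)
  qed
  then have "AE x in lebesgue_on \<Omega>. \<forall>b\<in>Basis. rep_L2 d x \<bullet> b = 0"
    by (intro AE_finite_allI) auto
  then have "AE x in lebesgue. x \<in> \<Omega> \<longrightarrow> rep_L2 d x = 0"
    using \<Omega> by (simp add: AE_restrict_space_iff euclidean_all_zero_iff)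
  moreover have "AE x in lebesgue. x \<notin> \<Omega> \<longrightarrow> rep_L2 d x = 0" using d by (simp add: L2_on_def)
  ultimately have "AE x in lebesgue. rep_L2 d x = 0" by eventually_elim blast
  then have "abs_L2 (rep_L2 d) = abs_L2 (\<lambda>_. 0)"
    by (simp add: abs_L2_eq_iff[OF rep_L2 square_integrable_zero])
  then have "d = 0" by (simp add: abs_rep_L2 zero_L2_def)
  then show ?thesis by (simp add: d_def)
qed

lemma weak_gradient_eq:
  assumes "open \<Omega>" "bounded \<Omega>" "has_weak_gradient \<Omega> u g"
  shows "weak_gradient \<Omega> u = g"
  unfolding weak_gradient_def using assms has_weak_gradient_unique by blast

section \<open>Coercivity\<close>

theorem proposition4p2:
  fixes T c\<^sub>0 :: real
    and \<Omega> :: "(real ^ 'n) set"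
    and c :: "real ^ 'n \<Rightarrow> real"
    and U :: "real \<Rightarrow> (real ^ 'n, real) L2"
  assumes "CARD('n) \<in> {1, 2, 3}"
    and "T > 0"
    and "bounded_lipschitz_domain \<Omega>"
    and "c \<in> Linfty_on \<Omega>"
    and "c\<^sub>0 > 0"
    and "AE x in lebesgue_on \<Omega>. c x \<ge> c\<^sub>0"
    and "U \<in> bochner_H1_H10 T \<Omega> \<inter> bochner_H2_0 T (L2_on \<Omega>)"
  shows "wave_form \<Omega> T c U (exp_weight_op T U) \<ge> 1 / (2 * exp 1 * T) * (energy_norm \<Omega> T c U)\<^sup>2"
proof -
  let ?M = "lebesgue_on {0<..<T}"
  define \<psi> where "\<psi> t = exp (- t / T)" for t
  define V where "V = weak_time_deriv T U"
  define V' where "V' = weak_time_deriv T V"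
  define G where "G t = weak_gradient \<Omega> (U t)" for t
  define W where "W = exp_weight_op T U"
  define W' where "W' = weak_time_deriv T W"
  have \<Omega>: "open \<Omega>" "bounded \<Omega>" using assms(3) by (auto simp: bounded_lipschitz_domain_def)
  then have \<Omega>_meas: "\<Omega> \<in> sets lebesgue" by (simp add: borel_open)
  have \<psi>_cont: "continuous_on {0..T} \<psi>"
    unfolding \<psi>_def using \<open>T > 0\<close> by (intro continuous_intros) auto

  obtain v w where v: "has_weak_time_deriv T U v" and w: "has_weak_time_deriv T v w"
      and trace_U: "time_trace T U 0 = 0"
    using assms(7) by (auto simp: bochner_H2_0_def bochner_H2_def)
  have V: "has_weak_time_deriv T U V"
    unfolding V_def by (rule has_weak_time_deriv_weak_time_deriv[OF v])
  then have V_int: "integrable ?M V" by (simp add: has_weak_time_deriv_def)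
  \<comment> \<open>The second derivative is given for \<open>v\<close>, whereas the form uses the
    chosen derivative \<open>V\<close>; the two differ on a null set, so \<open>w\<close> is a weak
    derivative of \<open>V\<close> as well.\<close>
  have "AE t in ?M. v t = V t" by (rule has_weak_time_deriv_unique[OF v V]) simp
  from has_weak_time_deriv_cong_AE[OF w V_int this]
  have V': "has_weak_time_deriv T V V'"
    unfolding V'_def by (rule has_weak_time_deriv_weak_time_deriv)
  then have V'_int: "integrable ?M V'" by (simp add: has_weak_time_deriv_def)
  obtain P where P: "has_indefinite_integral T V' P" and V_P: "AE t in ?M. V t = P t"
    using has_weak_time_deriv_imp_indefinite_integral[OF \<open>T > 0\<close> V'] by blast
  have P_cont: "continuous_on {0..T} P" by (rule has_indefinite_integral_continuous[OF P])

  have "integrable ?M (\<lambda>t. \<psi> t *\<^sub>R V t)"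
    by (rule integrable_continuous_bilinear[OF bounded_bilinear_scaleR \<psi>_cont V_int])
  \<comment> \<open>\<open>W\<close> vanishes at 0, being an integral over an empty interval, so its
    definition is already the required representation.\<close>
  then have "has_indefinite_integral T (\<lambda>t. \<psi> t *\<^sub>R V t) W"
    unfolding has_indefinite_integral_def
    by (simp add: W_def exp_weight_op_def \<psi>_def V_def integral_empty)
  then have W: "has_weak_time_deriv T W (\<lambda>t. \<psi> t *\<^sub>R V t)"
    using \<open>T > 0\<close> by (rule has_weak_time_deriv_indefinite_integral)
  then have W': "has_weak_time_deriv T W W'"
    unfolding W'_def by (rule has_weak_time_deriv_weak_time_deriv)
  then have W'_int: "integrable ?M W'" by (simp add: has_weak_time_deriv_def)
  have W'_V: "AE t in ?M. W' t = \<psi> t *\<^sub>R V t" by (rule has_weak_time_deriv_unique[OF W' W]) simp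
  then have W'_P: "AE t in ?M. W' t = \<psi> t *\<^sub>R P t"
    using V_P by eventually_elim simp
  have \<psi>P_cont: "continuous_on {0..T} (\<lambda>t. \<psi> t *\<^sub>R P t)" by (intro continuous_intros \<psi>_cont P_cont)

  \<comment> \<open>Both traces equal \<open>P 0\<close> because the weight is 1 at time 0; their
    product in the form is therefore the full square of the norm.\<close>
  have trace_V: "time_trace T V 0 = P 0" using \<open>T > 0\<close> by (intro time_trace_eq P_cont V_P) auto
  have trace_W': "time_trace T W' 0 = P 0"
    using time_trace_eq[OF \<psi>P_cont W'_P \<open>T > 0\<close>, of 0] \<open>T > 0\<close> by (simp add: \<psi>_def)

  \<comment> \<open>\<open>vg\<close> is the derivative of the pair (U, \<nabla>U). Since its values
    lie in the graph, the second component is the gradient of the first, which is the time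
    derivative of U.\<close>
  obtain vg where vg: "has_weak_time_deriv T (\<lambda>t. (U t, G t)) vg"
      and vg_H10: "AE t in ?M. vg t \<in> H10_graph \<Omega>" and UG_H10: "AE t in ?M. (U t, G t) \<in> H10_graph \<Omega>"
    using assms(7) by (auto simp: bochner_H1_H10_def bochner_H1_def bochner_L2_def G_def)
  obtain R where R: "has_indefinite_integral T vg R" and UG_R: "AE t in ?M. (U t, G t) = R t"
    using has_weak_time_deriv_imp_indefinite_integral[OF \<open>T > 0\<close> vg] by blast
  have R_cont: "continuous_on {0..T} R" by (rule has_indefinite_integral_continuous[OF R])
  have U_R: "AE t in ?M. U t = fst (R t)" using UG_R by eventually_elim (metis fst_conv)
  have G_R: "AE t in ?M. G t = snd (R t)" using UG_R by eventually_elim (metis snd_conv)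
  have "has_weak_time_deriv T (\<lambda>t. fst (R t)) (\<lambda>t. fst (vg t))"
    using \<open>T > 0\<close>
    by (intro has_weak_time_deriv_indefinite_integral has_indefinite_integral_bounded_linear[OF bounded_linear_fst R])
  then have V_vg: "AE t in ?M. V t = fst (vg t)"
    using has_weak_time_deriv_unique[OF V _ U_R] by blast
  \<comment> \<open>Membership is known only for almost every time and says nothing directly about
    time 0; the continuity of \<open>R\<close> bridges this gap.\<close>
  have "AE t in ?M. R t \<in> H1_graph \<Omega>"
    using UG_H10 UG_R by eventually_elim (auto simp: H10_graph_def)
  then have "R 0 \<in> H1_graph \<Omega>"
    using \<open>T > 0\<close> by (intro continuous_on_AE_mem_closed[OF R_cont closed_H1_graph[OF \<Omega>_meas]]) auto
  moreover have "fst (R 0) = 0"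
    using time_trace_eq[OF continuous_on_fst[OF R_cont] U_R \<open>T > 0\<close>, of 0] trace_U \<open>T > 0\<close> by simp
  ultimately have "has_weak_gradient \<Omega> 0 (snd (R 0))"
    by (auto simp: H1_graph_def split: prod.splits)
  then have R0: "snd (R 0) = 0"
    by (rule has_weak_gradient_unique[OF \<Omega>]) (rule has_weak_gradient_0[OF \<Omega>_meas])

  interpret mult: bounded_linear "mult_L2 \<Omega> c :: (real ^ 'n, real ^ 'n) L2 \<Rightarrow> _"
    by (rule bounded_linear_mult_L2[OF assms(4) \<Omega>_meas])
  define Q where "Q t = mult_L2 \<Omega> c (snd (R t))" for t
  define q where "q t = mult_L2 \<Omega> c (snd (vg t))" for t
  have Q: "has_indefinite_integral T q Q"
    unfolding Q_def q_def
    by (intro has_indefinite_integral_bounded_linear[OF mult.bounded_linear_axioms]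
        has_indefinite_integral_bounded_linear[OF bounded_linear_snd] R)
  have Q_cont: "continuous_on {0..T} Q" by (rule has_indefinite_integral_continuous[OF Q])
  have Q0: "Q 0 = 0" by (simp add: Q_def R0 mult.zero)
  have G_Q: "AE t in ?M. mult_L2 \<Omega> c (G t) = Q t" using G_R by eventually_elim (simp add: Q_def)

  have time_term: "(LINT t|?M. V' t \<bullet> W' t) = (LINT t|?M. V' t \<bullet> exp (- t / T) *\<^sub>R P t)"
  proof (rule integral_cong_AE)
    show "AE t in ?M. V' t \<bullet> W' t = V' t \<bullet> exp (- t / T) *\<^sub>R P t"
      using W'_P by eventually_elim (simp add: \<psi>_def)
    have [measurable]: "V' \<in> borel_measurable ?M" "W' \<in> borel_measurable ?M" "P \<in> borel_measurable ?M"
      using V'_int W'_int continuous_on_interval_measurable[OF P_cont] by simp_all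
    show "(\<lambda>t. V' t \<bullet> W' t) \<in> borel_measurable ?M" by measurable
    show "(\<lambda>t. V' t \<bullet> exp (- t / T) *\<^sub>R P t) \<in> borel_measurable ?M"
      using continuous_on_interval_measurable[OF \<psi>P_cont] unfolding \<psi>_def
      by (intro borel_measurable_inner) simp_all
  qed

  have space_term: "(LINT t|?M. mult_L2 \<Omega> (\<lambda>x. (c x)\<^sup>2) (G t) \<bullet> weak_gradient \<Omega> (W' t)) =
      (LINT t|?M. q t \<bullet> exp (- t / T) *\<^sub>R Q t)"
  proof -
    \<comment> \<open>The side known to be measurable stands on the left: measurability is then
      transferred to the integrand containing \<open>weak_gradient\<close>.\<close>
    have ae: "AE t in ?M. q t \<bullet> exp (- t / T) *\<^sub>R Q t =
        mult_L2 \<Omega> (\<lambda>x. (c x)\<^sup>2) (G t) \<bullet> weak_gradient \<Omega> (W' t)"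
      using W'_V V_vg vg_H10 G_Q
    proof eventually_elim
      fix t assume *: "W' t = \<psi> t *\<^sub>R V t" "V t = fst (vg t)" "vg t \<in> H10_graph \<Omega>" "mult_L2 \<Omega> c (G t) = Q t"
      then have "has_weak_gradient \<Omega> (W' t) (\<psi> t *\<^sub>R snd (vg t))"
        by (auto simp: H10_graph_def H1_graph_def split: prod.splits
            intro: has_weak_gradient_scaleR[OF \<Omega>_meas])
      then have grad: "weak_gradient \<Omega> (W' t) = \<psi> t *\<^sub>R snd (vg t)" by (rule weak_gradient_eq[OF \<Omega>])
      show "q t \<bullet> exp (- t / T) *\<^sub>R Q t = mult_L2 \<Omega> (\<lambda>x. (c x)\<^sup>2) (G t) \<bullet> weak_gradient \<Omega> (W' t)"
        unfolding inner_mult_L2_power2[OF assms(4) \<Omega>_meas] *(4) grad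
        by (simp add: mult.scaleR q_def \<psi>_def inner_commute)
    qed
    have "(\<lambda>t. q t \<bullet> exp (- t / T) *\<^sub>R Q t) \<in> borel_measurable ?M"
    proof (intro borel_measurable_inner)
      show "q \<in> borel_measurable ?M" using has_indefinite_integral_integrable[OF Q] by simp
      show "(\<lambda>t. exp (- t / T) *\<^sub>R Q t) \<in> borel_measurable ?M"
        using continuous_on_interval_measurable[OF continuous_on_scaleR[OF \<psi>_cont Q_cont]]
        by (simp add: \<psi>_def)
    qed
    then show ?thesis
      using measurable_lebesgue_on_AE[OF _ _ ae] ae by (intro integral_cong_AE) (auto elim: AE_mp)
  qed

  have norm_V: "(LINT t|?M. (norm (V t))\<^sup>2) = (LINT t|?M. (norm (P t))\<^sup>2)"
  proof (rule integral_cong_AE)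
    show "AE t in ?M. (norm (V t))\<^sup>2 = (norm (P t))\<^sup>2" using V_P by eventually_elim simp
  qed (use V_int continuous_on_interval_measurable[OF P_cont] in simp_all)
  have norm_G: "(LINT t|?M. (norm (mult_L2 \<Omega> c (G t)))\<^sup>2) = (LINT t|?M. (norm (Q t))\<^sup>2)"
  proof (rule integral_cong_AE)
    show "AE t in ?M. (norm (mult_L2 \<Omega> c (G t)))\<^sup>2 = (norm (Q t))\<^sup>2" using G_Q by eventually_elim simp
    have Q_meas: "Q \<in> borel_measurable ?M" by (rule continuous_on_interval_measurable[OF Q_cont])
    then show "(\<lambda>t. (norm (Q t))\<^sup>2) \<in> borel_measurable ?M" by simp
    have "(\<lambda>t. mult_L2 \<Omega> c (G t)) \<in> borel_measurable ?M"
      by (rule measurable_lebesgue_on_AE[OF Q_meas]) (use G_Q in \<open>auto elim: AE_mp\<close>)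
    then show "(\<lambda>t. (norm (mult_L2 \<Omega> c (G t)))\<^sup>2) \<in> borel_measurable ?M" by simp
  qed
  have "(energy_norm \<Omega> T c U)\<^sup>2 = (LINT t|?M. (norm (P t))\<^sup>2) + (LINT t|?M. (norm (Q t))\<^sup>2)"
    unfolding energy_norm_def V_def[symmetric] G_def[symmetric] norm_V norm_G by simp
  moreover have "wave_form \<Omega> T c U (exp_weight_op T U) =
      (LINT t|?M. V' t \<bullet> exp (- t / T) *\<^sub>R P t) + (norm (P 0))\<^sup>2 + (LINT t|?M. q t \<bullet> exp (- t / T) *\<^sub>R Q t)"
    unfolding wave_form_def W_def[symmetric] W'_def[symmetric] V_def[symmetric] V'_def[symmetric]
      G_def[symmetric] time_term space_term trace_V trace_W' power2_norm_eq_inner ..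
  \<comment> \<open>The estimate for \<open>P\<close> uses only half of the trace term; the other
    half is nonnegative and is discarded.\<close>
  moreover have "0 \<le> (norm (P 0))\<^sup>2" by simp
  moreover have "(norm (Q 0))\<^sup>2 / 2 = 0" by (simp add: Q0)
  ultimately show ?thesis
    using exp_weighted_energy_inequality[OF \<open>T > 0\<close> P] exp_weighted_energy_inequality[OF \<open>T > 0\<close> Q]
    by (simp only: distrib_left)
qed

end
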